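(* Let $\Delta\ge 3$ and let $f:\mathbb N\to\mathbb N$ be a subexponential function. Let $\mathbf F\subseteq\mathbb F_f$ be a class of finite graphs of growth bounded by $f$, of maximum degree at most $\Delta$, none of which contains the complete graph $K_{\Delta+1}$ as a subgraph. Then there is a deterministic distributed algorithm in the LOCAL model of complexity $O(\log^* n)$ that produces a proper vertex coloring with $\Delta$ colors of every graph in $\mathbf F$.
   Context: A function $f:\mathbb N\to\mathbb N$ is subexponential if $f\in o((1+\varepsilon)^n)$ for every $\varepsilon>0$. $f$ bounds the growth of a graph $G$ if $|B_G(v,r)|<f(r)$ for every vertex $v$ and every $r$, where $B_G(v,r)$ is the set of vertices at graph distance at most $r$ from $v$; $\mathbb F_f$ is the class of graphs whose growth is bounded by $f$. LOCAL model (deterministic): each graph on $n$ vertices comes with an adversarial injective identifier assignment $V\to\{1,\dots,n^c\}$ for a fixed constant $c$, $n$ is known, and an algorithm of complexity $t_n$ determines the output of each vertex $v$ as a function of the $t_n$-ball around $v$ with its identifiers; it must be correct for every graph in the class and every identifier assignment. $\log^* n$ is the number of times $\log$ must be applied to $n$ to reach a value at most $2$. The maximum degree $\Delta$ is treated as a constant. *)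

theory Defs
  imports
    Complex_Main
    "HOL-Library.Landau_Symbols"
    "Graph_Theory.Graph_Theory"
begin

text \<open>
  As in the graph library, a finite simple graph is a finite, symmetric, loop-free digraph
  without parallel arcs (\<^locale>\<open>pair_graph\<close>); the degree of a vertex is its out-degree.
\<close>

subsection \<open>Growth\<close>

definition graph_ball :: "'a pair_pre_digraph \<Rightarrow> 'a \<Rightarrow> nat \<Rightarrow> 'a set" where
  "graph_ball G v r =
     {u \<in> pverts G. wf_digraph.\<mu> (with_proj G) (\<lambda>_. 1) v u \<le> ereal (real r)}"

definition growth_bounded :: "(nat \<Rightarrow> nat) \<Rightarrow> 'a pair_pre_digraph \<Rightarrow> bool" where
  "growth_bounded f G \<longleftrightarrow>
     (\<forall>v \<in> pverts G. \<forall>r. finite (graph_ball G v r) \<and> card (graph_ball G v r) < f r)"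

definition subexponential :: "(nat \<Rightarrow> nat) \<Rightarrow> bool" where
  "subexponential f \<longleftrightarrow> (\<forall>\<epsilon>>0. (\<lambda>n. real (f n)) \<in> o(\<lambda>n. (1 + \<epsilon> :: real) ^ n))"

text \<open>
  Distances are infima of walk lengths in the extended reals, so a vertex that is not
  reachable from \<open>v\<close> lies in no ball around \<open>v\<close>.
\<close>

lemma graph_ball_iff_awalk:
  assumes "pair_wf_digraph G"
  shows "u \<in> graph_ball G v r \<longleftrightarrow>
    (\<exists>p. pre_digraph.awalk (with_proj G) v p u \<and> length p \<le> r)"
proof -
  interpret pair_wf_digraph G by fact
  have cost: "awalk_cost (\<lambda>_. 1) p = real (length p)" for p :: "('a \<times> 'a) list"
    by (induction p) auto
  have "\<exists>p. awalk v p u \<and> length p \<le> r"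
    if "\<mu> (\<lambda>_. 1) v u \<le> ereal (real r)"
  proof (rule ccontr)
    assume "\<nexists>p. awalk v p u \<and> length p \<le> r"
    then have "ereal (real r + 1) \<le> \<mu> (\<lambda>_. 1) v u"
      unfolding \<mu>_def by (intro INF_greatest) (force simp: cost)
    then have "ereal (real r + 1) \<le> ereal (real r)"
      using that by (rule order_trans)
    then show False by simp
  qed
  moreover have "\<mu> (\<lambda>_. 1) v u \<le> ereal (real r)" if "awalk v p u" "length p \<le> r" for p
    using min_cost_le_walk_cost[OF that(1), of "\<lambda>_. 1"] that(2)
    by (simp add: cost order.trans)
  ultimately show ?thesis
    unfolding graph_ball_def using awalk_last_in_verts by blast
qed

subsection \<open>Iterated logarithm\<close>

definition log_star :: "nat \<Rightarrow> nat" where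
  "log_star n = (LEAST k. (log 2 ^^ k) (real n) \<le> 2)"

lemma log_star_le_2: "(log 2 ^^ log_star n) (real n) \<le> 2"
proof -
  have "\<exists>k. (log 2 ^^ k) x \<le> 2" if "x \<le> real m + 2" for m :: nat and x :: real
    using that
  proof (induction m arbitrary: x)
    case 0
    then show ?case by (intro exI[of _ 0]) simp
  next
    case (Suc m)
    show ?case
    proof (cases "x \<le> 2")
      case True
      then show ?thesis by (intro exI[of _ 0]) simp
    next
      case False
      have "m + 2 < 2 ^ (m + 2)" by (rule less_exp)
      then have "real (m + 3) \<le> real (2 ^ (m + 2))" unfolding of_nat_le_iff by linarith
      then have "x \<le> 2 powr real (m + 2)"
        using Suc.prems by (subst powr_realpow) auto
      then have "log 2 x \<le> real m + 2"
        using False by (subst log_le_iff) (simp_all add: add.commute)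
      from Suc.IH[OF this] obtain k where "(log 2 ^^ k) (log 2 x) \<le> 2" ..
      then show ?thesis by (intro exI[of _ "Suc k"]) (simp add: funpow_swap1)
    qed
  qed
  from this[of "real n" n] have "\<exists>k. (log 2 ^^ k) (real n) \<le> 2" by simp
  then show ?thesis unfolding log_star_def by (rule LeastI_ex)
qed

subsection \<open>The deterministic LOCAL model\<close>

text \<open>
  The radius-\<open>t\<close> view of \<open>v\<close> consists of the identifier of \<open>v\<close> and the subgraph induced by
  the \<open>t\<close>-ball around \<open>v\<close>, every vertex being replaced by its identifier. An algorithm sees
  nothing else of the graph except the number of vertices, so its output cannot depend on the
  names of the vertices.
\<close>

type_synonym local_view = "nat \<times> nat pair_pre_digraph"

type_synonym 'o local_algorithm = "nat \<Rightarrow> local_view \<Rightarrow> 'o"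

definition local_view :: "'a pair_pre_digraph \<Rightarrow> ('a \<Rightarrow> nat) \<Rightarrow> nat \<Rightarrow> 'a \<Rightarrow> local_view" where
  "local_view G ident t v =
     (ident v,
      \<lparr> pverts = ident ` graph_ball G v t,
        parcs = {(ident x, ident y) | x y.
                   (x, y) \<in> parcs G \<and> x \<in> graph_ball G v t \<and> y \<in> graph_ball G v t} \<rparr>)"

definition local_output ::
    "'o local_algorithm \<Rightarrow> (nat \<Rightarrow> nat) \<Rightarrow> 'a pair_pre_digraph \<Rightarrow> ('a \<Rightarrow> nat) \<Rightarrow> 'a \<Rightarrow> 'o" where
  "local_output A t G ident v =
     (let n = card (pverts G) in A n (local_view G ident (t n) v))"

definition identifier_assignment :: "nat \<Rightarrow> 'a pair_pre_digraph \<Rightarrow> ('a \<Rightarrow> nat) \<Rightarrow> bool" where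
  "identifier_assignment c G ident \<longleftrightarrow>
     inj_on ident (pverts G) \<and> ident ` pverts G \<subseteq> {1..card (pverts G) ^ c}"

subsection \<open>Coloring\<close>

definition proper_coloring :: "nat \<Rightarrow> 'a pair_pre_digraph \<Rightarrow> ('a \<Rightarrow> nat) \<Rightarrow> bool" where
  "proper_coloring k G col \<longleftrightarrow>
     (\<forall>v \<in> pverts G. col v < k) \<and> (\<forall>(u, v) \<in> parcs G. col u \<noteq> col v)"

end

theory Submission
  imports Defs
begin

text \<open>
  Call a set degree-choosable if it can be coloured from any lists at least as large as the degrees
  inside the set. Suppose that a ball contains no vertex of degree less than \<open>\<Delta>\<close> and no
  degree-choosable set. A biconnected set without degree-choosable subset is a clique or a cycle
  (which is odd), so in the breadth-first layering of the ball every vertex has a single parent,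
  and a vertex with a single child has a child with at least two children. Hence the layers double
  every two steps. As the growth is subexponential, this is impossible for a large constant radius
  \<open>R\<close>: every ball of radius \<open>R\<close> contains a core, that is, a set to which every \<open>\<Delta>\<close>-colouring of
  the outside extends.

  The algorithm first colours a constant power of the graph with boundedly many colours in \<open>O(log\<^sup>* n)\<close>
  rounds. In constantly many further rounds it selects a maximal family of cores that are pairwise
  neither overlapping nor adjacent, colours the other vertices greedily, those farthest from the cores first, so
  that each still has an uncoloured neighbour when its turn comes, and finally extends the colouring
  to the cores.
\<close>

subsection \<open>Connectivity and list colouring\<close>

text \<open>No paths or cycles occur as objects. Connectivity is stated by cuts, and a cycle is
  replaced by a vertex together with a connected set that is smallest among those containing two of
  its neighbours; minimality yields biconnectivity. Two biconnected sets that share two vertices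
  have a biconnected union. In a ball without choosable subsets such a union is 2-regular as soon as
  it contains a nonadjacent pair, so most claims about layers follow by exhibiting a third neighbour
  inside it. The excluded complete graph starts the growth: it keeps a ball from ending after one
  layer.

  The algorithm is written as a function of an edge relation on a whole type, without a vertex set.
  Applied to identifiers, this makes views of different graphs comparable, since the same names are
  used in all of them; the price is that natural numbers which are no identifiers appear as isolated
  points and have to be covered by the bounds.\<close>

definition connected_set :: "('a \<times> 'a) set \<Rightarrow> 'a set \<Rightarrow> bool" where
  "connected_set E S \<longleftrightarrow>
     (\<forall>A \<subseteq> S. A \<noteq> {} \<longrightarrow> A \<noteq> S \<longrightarrow> (\<exists>x\<in>A. \<exists>y\<in>S - A. (x, y) \<in> E))"

definition degree_in :: "('a \<times> 'a) set \<Rightarrow> 'a set \<Rightarrow> 'a \<Rightarrow> nat" where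
  "degree_in E S x = card (E `` {x} \<inter> S)"

definition list_coloring :: "('a \<times> 'a) set \<Rightarrow> 'a set \<Rightarrow> ('a \<Rightarrow> nat set) \<Rightarrow> ('a \<Rightarrow> nat) \<Rightarrow> bool" where
  "list_coloring E S L \<phi> \<longleftrightarrow>
     (\<forall>x\<in>S. \<phi> x \<in> L x \<and> (\<forall>y\<in>S. (x, y) \<in> E \<longrightarrow> \<phi> x \<noteq> \<phi> y))"

definition degree_choosable :: "('a \<times> 'a) set \<Rightarrow> 'a set \<Rightarrow> bool" where
  "degree_choosable E S \<longleftrightarrow> S \<noteq> {} \<and> finite S \<and>
     (\<forall>L. (\<forall>x\<in>S. finite (L x) \<and> degree_in E S x \<le> card (L x)) \<longrightarrow> (\<exists>\<phi>. list_coloring E S L \<phi>))"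

definition biconnected :: "('a \<times> 'a) set \<Rightarrow> 'a set \<Rightarrow> bool" where
  "biconnected E S \<longleftrightarrow> finite S \<and> 3 \<le> card S \<and> connected_set E S \<and>
     (\<forall>x\<in>S. connected_set E (S - {x}))"

definition clique :: "('a \<times> 'a) set \<Rightarrow> 'a set \<Rightarrow> bool" where
  "clique E S \<longleftrightarrow> (\<forall>x\<in>S. \<forall>y\<in>S. x \<noteq> y \<longrightarrow> (x, y) \<in> E)"

lemma connected_setD:
  assumes "connected_set E S" "A \<subseteq> S" "A \<noteq> {}" "A \<noteq> S"
  obtains x y where "x \<in> A" "y \<in> S" "y \<notin> A" "(x, y) \<in> E"
  using assms unfolding connected_set_def by blast

lemma connected_set_singleton [simp]: "connected_set E {x}"
  unfolding connected_set_def by blast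

locale simple_graph =
  fixes E :: "('a \<times> 'a) set"
  assumes E_sym: "(x, y) \<in> E \<Longrightarrow> (y, x) \<in> E"
    and E_irrefl: "(x, x) \<notin> E"
    and finite_neighbours: "finite (E `` {x})"
begin

lemma finite_nb [simp]: "finite (E `` {x} \<inter> S)"
  using finite_neighbours by blast

lemma degree_in_mono: "S \<subseteq> T \<Longrightarrow> degree_in E S x \<le> degree_in E T x"
  unfolding degree_in_def by (intro card_mono) auto

lemma degree_in_less:
  assumes "S \<subseteq> T" "(x, y) \<in> E" "y \<in> T" "y \<notin> S"
  shows "degree_in E S x < degree_in E T x"
  unfolding degree_in_def by (rule psubset_card_mono) (use assms in auto)

subsection \<open>Connected vertex sets\<close>

lemma connected_set_Un:
  assumes "connected_set E A" "connected_set E B" "A \<inter> B \<noteq> {}"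
  shows "connected_set E (A \<union> B)"
  unfolding connected_set_def
proof (intro allI impI)
  fix C assume C: "C \<subseteq> A \<union> B" "C \<noteq> {}" "C \<noteq> A \<union> B"
  have "(C \<inter> A \<noteq> {} \<and> C \<inter> A \<noteq> A) \<or> (C \<inter> B \<noteq> {} \<and> C \<inter> B \<noteq> B)"
    using C assms(3) by blast
  then show "\<exists>x\<in>C. \<exists>y\<in>A \<union> B - C. (x, y) \<in> E"
  proof
    assume *: "C \<inter> A \<noteq> {} \<and> C \<inter> A \<noteq> A"
    from connected_setD[OF assms(1), of "C \<inter> A"] * show ?thesis by blast
  next
    assume *: "C \<inter> B \<noteq> {} \<and> C \<inter> B \<noteq> B"
    from connected_setD[OF assms(2), of "C \<inter> B"] * show ?thesis by blast
  qed
qed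

lemma connected_set_pair: "(a, b) \<in> E \<Longrightarrow> connected_set E {a, b}"
  unfolding connected_set_def
proof (intro allI impI)
  fix C assume "(a, b) \<in> E" "C \<subseteq> {a, b}" "C \<noteq> {}" "C \<noteq> {a, b}"
  then have "C = {a} \<or> C = {b}" by blast
  with \<open>(a, b) \<in> E\<close> E_sym[of a b] E_irrefl show "\<exists>x\<in>C. \<exists>y\<in>{a, b} - C. (x, y) \<in> E" by blast
qed

lemma connected_set_Un_edge:
  assumes "connected_set E A" "connected_set E B" "a \<in> A" "b \<in> B" "(a, b) \<in> E"
  shows "connected_set E (A \<union> B)"
proof -
  have "connected_set E (A \<union> {a, b})"
    using assms connected_set_pair[OF assms(5)] by (intro connected_set_Un) auto
  then have "connected_set E ((A \<union> {a, b}) \<union> B)"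
    by (rule connected_set_Un) (use assms in auto)
  moreover have "(A \<union> {a, b}) \<union> B = A \<union> B" using assms by blast
  ultimately show ?thesis by simp
qed

lemma connected_set_insert:
  assumes "connected_set E A" "a \<in> A" "(a, b) \<in> E"
  shows "connected_set E (insert b A)"
  using connected_set_Un_edge[OF assms(1) connected_set_singleton assms(2) _ assms(3)] by simp

lemma clique_connected_set: "clique E S \<Longrightarrow> connected_set E S"
  unfolding clique_def connected_set_def by (metis DiffI all_not_in_conv subset_antisym subset_eq)

text \<open>A largest connected proper subset containing \<open>z\<close> misses exactly one vertex:
  adding any vertex joined to it gives a connected set again, which by maximality is all of
  \<open>T\<close>.\<close>

lemma ex_noncut:
  assumes "finite T" "connected_set E T" "z \<in> T" "T \<noteq> {z}"
  obtains x where "x \<in> T" "x \<noteq> z" "connected_set E (T - {x})"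
proof -
  define P where "P C \<longleftrightarrow> C \<subset> T \<and> z \<in> C \<and> connected_set E C" for C
  have "P {z}" using assms by (auto simp: P_def)
  moreover have "\<forall>C. P C \<longrightarrow> card C \<le> card T"
    using assms(1) unfolding P_def by (auto intro: card_mono)
  ultimately obtain C where C: "P C" "\<And>D. P D \<Longrightarrow> card D \<le> card C"
    using ex_has_greatest_nat[of P "{z}" card "Suc (card T)"] by (metis le_imp_less_Suc)
  from C(1) assms(2) obtain x y where xy: "x \<in> C" "y \<in> T" "y \<notin> C" "(x, y) \<in> E"
    unfolding P_def by (metis connected_setD empty_iff psubset_eq)
  have "connected_set E (insert y C)"
    using C(1) xy connected_set_insert unfolding P_def by blast
  moreover have "card (insert y C) > card C"
    using xy C(1) assms(1) finite_subset[of C T] unfolding P_def by auto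
  ultimately have "insert y C = T" using C(1) C(2)[of "insert y C"] xy unfolding P_def
    by (metis insert_iff insert_subset leD psubset_eq)
  then have "T - {y} = C" using xy by blast
  with C(1) xy that[of y] show ?thesis unfolding P_def by blast
qed

text \<open>The arguments with a smallest connected set \<open>T\<close> rest on this: a part of \<open>T\<close> attached only to \<open>x\<close>
  could be dropped.\<close>

lemma connected_set_drop:
  assumes "connected_set E T" "x \<in> T" "A \<subseteq> T - {x}"
    and "\<And>y z. y \<in> A \<Longrightarrow> z \<in> T - {x} - A \<Longrightarrow> (y, z) \<notin> E"
  shows "connected_set E (T - A)"
  unfolding connected_set_def
proof (intro allI impI)
  fix C assume C: "C \<subseteq> T - A" "C \<noteq> {}" "C \<noteq> T - A"
  show "\<exists>a\<in>C. \<exists>b\<in>T - A - C. (a, b) \<in> E"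
  proof (cases "x \<in> C")
    case True
    have "C \<union> A \<subseteq> T" "C \<union> A \<noteq> {}" "C \<union> A \<noteq> T" using C assms(3) by auto
    from connected_setD[OF assms(1) this] obtain a b
      where "a \<in> C \<union> A" "b \<in> T" "b \<notin> C \<union> A" "(a, b) \<in> E" by blast
    with True assms(4)[of a b] show ?thesis by blast
  next
    case False
    have "C \<subseteq> T" "C \<noteq> {}" "C \<noteq> T" using C assms(2,3) False by auto
    from connected_setD[OF assms(1) this] obtain a b
      where "a \<in> C" "b \<in> T" "b \<notin> C" "(a, b) \<in> E" by blast
    with False assms(4)[of b a] C E_sym[of a b] show ?thesis by blast
  qed
qed

text \<open>A cut that splits \<open>M\<close> is crossed inside \<open>M\<close>; otherwise one
  side \<open>A\<close> avoids \<open>M\<close>. Without an edge to the rest, \<open>A\<close> would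
  hang on \<open>x\<close> alone, \<open>T - A\<close> would be connected, and \<open>min\<close>
  would supply an edge to \<open>M\<close>. The premise \<open>min\<close> is what a smallest choice
  of \<open>T\<close> provides, so this settles the removal of a vertex in all three constructions
  by minimality.\<close>

lemma connected_set_attach:
  assumes "connected_set E M" "M \<noteq> {}" "connected_set E T" "M \<inter> T = {}" "x \<in> T"
    and min: "\<And>A. A \<subseteq> T - {x} \<Longrightarrow> A \<noteq> {} \<Longrightarrow> connected_set E (T - A)
                \<Longrightarrow> \<exists>y\<in>A. \<exists>z\<in>M. (y, z) \<in> E"
  shows "connected_set E (M \<union> (T - {x}))"
proof -
  have key: "\<exists>y\<in>A. \<exists>z\<in>M \<union> (T - {x}) - A. (y, z) \<in> E" if A: "A \<subseteq> T - {x}" "A \<noteq> {}" for A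
  proof (rule ccontr)
    assume *: "\<not> ?thesis"
    have "connected_set E (T - A)"
      by (rule connected_set_drop[OF assms(3,5) A(1)]) (use * in blast)
    from min[OF A this] obtain y z where "y \<in> A" "z \<in> M" "(y, z) \<in> E" by blast
    moreover have "z \<notin> A" using A(1) \<open>z \<in> M\<close> assms(4) by blast
    ultimately show False using * by blast
  qed
  show ?thesis
    unfolding connected_set_def
  proof (intro allI impI)
    fix C assume C: "C \<subseteq> M \<union> (T - {x})" "C \<noteq> {}" "C \<noteq> M \<union> (T - {x})"
    consider "C \<inter> M = {}" | "M \<subseteq> C" | "C \<inter> M \<noteq> {}" "C \<inter> M \<noteq> M" by blast
    then show "\<exists>a\<in>C. \<exists>b\<in>M \<union> (T - {x}) - C. (a, b) \<in> E"
    proof cases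
      case 1
      then show ?thesis using key[of C] C by blast
    next
      case 2
      have "M \<union> (T - {x}) - C \<subseteq> T - {x}" "M \<union> (T - {x}) - C \<noteq> {}" using 2 C by auto
      from key[OF this] show ?thesis using E_sym by blast
    next
      case 3
      from connected_setD[OF assms(1), of "C \<inter> M"] 3 show ?thesis by blast
    qed
  qed
qed

lemma ex_least_card:
  assumes "P (T :: 'b set)"
  obtains T' where "P T'" "\<And>T''. P T'' \<Longrightarrow> card T' \<le> card T''"
  using ex_has_least_nat[of P T card] assms by blast

lemma ex_minimal_connector:
  assumes "connected_set E X" "finite X" "a \<in> X" "b \<in> X"
  obtains J where "J \<subseteq> X" "a \<in> J" "b \<in> J" "connected_set E J"
    "\<And>J'. J' \<subseteq> X \<Longrightarrow> a \<in> J' \<Longrightarrow> b \<in> J' \<Longrightarrow> connected_set E J' \<Longrightarrow> card J \<le> card J'"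
proof -
  let ?P = "\<lambda>J. J \<subseteq> X \<and> a \<in> J \<and> b \<in> J \<and> connected_set E J"
  have "?P X" using assms by simp
  from ex_least_card[of ?P, OF this] that show ?thesis by metis
qed

subsection \<open>Biconnected sets\<close>

lemma biconnected_Un:
  assumes "biconnected E A" "biconnected E B" "x \<in> A \<inter> B" "y \<in> A \<inter> B" "x \<noteq> y"
  shows "biconnected E (A \<union> B)"
proof -
  have "connected_set E (A \<union> B - {z})" if "z \<in> A \<union> B" for z
  proof -
    have "connected_set E (A - {z})" "connected_set E (B - {z})"
      using assms(1,2) unfolding biconnected_def by (metis Diff_empty Diff_insert0)+
    moreover have "(A - {z}) \<inter> (B - {z}) \<noteq> {}" using assms(3-5) by blast
    ultimately have "connected_set E ((A - {z}) \<union> (B - {z}))" by (rule connected_set_Un)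
    then show ?thesis by (simp add: Un_Diff)
  qed
  moreover have "card A \<le> card (A \<union> B)"
    using assms(1,2) by (intro card_mono) (auto simp: biconnected_def)
  moreover have "connected_set E (A \<union> B)"
    using assms by (intro connected_set_Un) (auto simp: biconnected_def)
  ultimately show ?thesis using assms(1,2) unfolding biconnected_def by auto
qed

text \<open>A smallest connected subset of \<open>X\<close> joining \<open>a\<close> and
  \<open>b\<close> behaves as a path, and \<open>u\<close> closes it to a cycle. A part that could
  be dropped contains \<open>a\<close> or \<open>b\<close> by minimality, hence a neighbour of
  \<open>u\<close>.\<close>

lemma ex_biconnected_through:
  assumes X: "connected_set E X" "finite X" "u \<notin> X" "a \<in> X" "b \<in> X" "a \<noteq> b"
    and u: "(u, a) \<in> E" "(u, b) \<in> E"
  obtains C where "biconnected E C" "C \<subseteq> insert u X" "u \<in> C" "a \<in> C" "b \<in> C"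
proof -
  obtain J where J: "J \<subseteq> X" "a \<in> J" "b \<in> J" "connected_set E J"
    "\<And>J'. J' \<subseteq> X \<Longrightarrow> a \<in> J' \<Longrightarrow> b \<in> J' \<Longrightarrow> connected_set E J' \<Longrightarrow> card J \<le> card J'"
    using ex_minimal_connector[OF X(1,2,4,5)] by blast
  have fin: "finite J" using J(1) X(2) finite_subset by blast
  have uJ: "u \<notin> J" using J(1) X(3) by blast
  have "connected_set E ({u} \<union> (J - {x}))" if x: "x \<in> J" for x
  proof (rule connected_set_attach[OF _ _ J(4) _ x])
    fix A assume A: "A \<subseteq> J - {x}" "A \<noteq> {}" "connected_set E (J - A)"
    have "card (J - A) < card J"
      using A fin x by (intro psubset_card_mono) auto
    then have "\<not> (a \<in> J - A \<and> b \<in> J - A)" using J(1) J(5)[of "J - A"] A(3) by auto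
    then show "\<exists>y\<in>A. \<exists>z\<in>{u}. (y, z) \<in> E" using J(2,3) u E_sym by blast
  qed (use uJ in auto)
  moreover have "insert u J - {x} = {u} \<union> (J - {x})" if "x \<in> J" for x
    using that uJ by blast
  moreover have "insert u J - {u} = J" using uJ by blast
  moreover have "connected_set E (insert u J)"
    using connected_set_insert[OF J(4,2)] u(1) E_sym by blast
  moreover have "card {u, a, b} \<le> card (insert u J)"
    using J(2,3) fin by (intro card_mono) auto
  moreover have "card {u, a, b} = 3" using X(3-6) by (auto simp: card_insert_if)
  ultimately have "biconnected E (insert u J)"
    using fin J(4) unfolding biconnected_def by auto
  with that[of "insert u J"] J(1-3) show ?thesis by blast
qed

lemma biconnected_degree_ge_2:
  assumes "biconnected E S" "u \<in> S"
  shows "2 \<le> degree_in E S u"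
proof (rule ccontr)
  assume "\<not> ?thesis"
  then have "card (E `` {u} \<inter> S) \<le> 1" by (simp add: degree_in_def)
  then obtain y where y: "E `` {u} \<inter> S \<subseteq> {y}"
    by (metis card_0_eq card_1_singletonE empty_subsetI finite_nb le_neq_implies_less less_one order_refl)
  show False
  proof (cases "y = u")
    case True
    then have "E `` {u} \<inter> S = {}" using y E_irrefl by blast
    moreover have "{u} \<noteq> S" using assms unfolding biconnected_def by auto
    moreover have "connected_set E S" "{u} \<subseteq> S" using assms unfolding biconnected_def by auto
    ultimately show False
      using connected_setD[of E S "{u}"] by blast
  next
    case False
    have "connected_set E (S - {y})"
      using assms(1) unfolding biconnected_def by (cases "y \<in> S") auto
    moreover have "{u} \<subseteq> S - {y}" using assms(2) False by blast
    moreover have "{u} \<noteq> S - {y}"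
    proof
      assume "{u} = S - {y}"
      then have "card S \<le> card {u, y}" by (intro card_mono) auto
      also have "\<dots> \<le> 2" by (simp add: card_insert_if)
      finally show False using assms(1) unfolding biconnected_def by simp
    qed
    ultimately obtain z where "z \<in> S - {y}" "z \<notin> {u}" "(u, z) \<in> E"
      using connected_setD[of E "S - {y}" "{u}"] by blast
    then show False using y by blast
  qed
qed

lemma clique_degree_in:
  assumes "clique E S" "x \<in> S" "finite S"
  shows "degree_in E S x = card S - 1"
proof -
  have "E `` {x} \<inter> S = S - {x}" using assms E_irrefl unfolding clique_def by auto
  then show ?thesis using assms by (simp add: degree_in_def)
qed

lemma clique_biconnected:
  assumes "clique E S" "finite S" "3 \<le> card S"
  shows "biconnected E S"
proof -
  have "clique E (S - {x})" for x using assms(1) by (auto simp: clique_def)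
  then show ?thesis using assms clique_connected_set by (auto simp: biconnected_def)
qed

subsection \<open>Colouring from lists\<close>

lemma list_coloring_extend:
  assumes "list_coloring E (S - {x}) L \<phi>" "c \<in> L x"
    and "\<And>y. y \<in> S \<Longrightarrow> (x, y) \<in> E \<Longrightarrow> \<phi> y \<noteq> c"
  shows "list_coloring E S L (\<phi>(x := c))"
  unfolding list_coloring_def
proof (intro ballI conjI impI)
  fix w y assume w: "w \<in> S"
  then show "(\<phi>(x := c)) w \<in> L w" using assms(1,2) by (auto simp: list_coloring_def)
  assume y: "y \<in> S" "(w, y) \<in> E"
  then have "w \<noteq> y" using E_irrefl by blast
  moreover have "\<phi> w \<noteq> \<phi> y" if "w \<noteq> x" "y \<noteq> x"
    using assms(1) w y that unfolding list_coloring_def by blast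
  ultimately show "(\<phi>(x := c)) w \<noteq> (\<phi>(x := c)) y"
    using assms(3)[of y] assms(3)[of w] w y E_sym[of w y] by auto
qed

lemma degenerate_colorable:
  assumes "finite S" "\<And>x. x \<in> S \<Longrightarrow> finite (L x)"
    and "\<And>A. A \<subseteq> S \<Longrightarrow> A \<noteq> {} \<Longrightarrow> \<exists>x\<in>A. degree_in E A x < card (L x)"
  shows "\<exists>\<phi>. list_coloring E S L \<phi>"
  using assms
proof (induction "card S" arbitrary: S)
  case 0
  then show ?case by (auto simp: list_coloring_def)
next
  case (Suc k)
  then have "S \<noteq> {}" by auto
  from Suc.prems(3)[OF order.refl this] obtain x where x: "x \<in> S" "degree_in E S x < card (L x)" by blast
  have "\<exists>\<phi>. list_coloring E (S - {x}) L \<phi>"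
    using Suc x by (intro Suc.hyps(1)) auto
  then obtain \<phi> where \<phi>: "list_coloring E (S - {x}) L \<phi>" ..
  have "card (\<phi> ` (E `` {x} \<inter> S)) < card (L x)"
    using x(2) card_image_le[of "E `` {x} \<inter> S" \<phi>] by (simp add: degree_in_def)
  then have "\<not> L x \<subseteq> \<phi> ` (E `` {x} \<inter> S)"
    using card_mono[of "\<phi> ` (E `` {x} \<inter> S)" "L x"] by auto
  then obtain c where "c \<in> L x" "c \<notin> \<phi> ` (E `` {x} \<inter> S)" by blast
  then show ?case using list_coloring_extend[OF \<phi>, of c] by blast
qed

text \<open>Greedy colouring towards \<open>z\<close>: a nonempty proper subset has a vertex with an
  edge leaving it, whose inner degree is therefore below its list size; only the whole set needs the
  slack of \<open>z\<close>.\<close>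

lemma slack_colorable:
  assumes "finite S" "connected_set E S" "\<And>x. x \<in> S \<Longrightarrow> finite (L x)"
    "\<And>x. x \<in> S \<Longrightarrow> degree_in E S x \<le> card (L x)" "z \<in> S" "degree_in E S z < card (L z)"
  shows "\<exists>\<phi>. list_coloring E S L \<phi>"
proof (rule degenerate_colorable[OF assms(1,3)])
  fix A assume A: "A \<subseteq> S" "A \<noteq> {}"
  show "\<exists>x\<in>A. degree_in E A x < card (L x)"
  proof (cases "A = S")
    case True
    then show ?thesis using assms(5,6) by blast
  next
    case False
    from connected_setD[OF assms(2) A False] obtain x y
      where "x \<in> A" "y \<in> S" "y \<notin> A" "(x, y) \<in> E" by blast
    with degree_in_less[OF A(1), of x y] assms(4)[of x] A show ?thesis by fastforce
  qed
qed

text \<open>Failing lists are tight by \<open>slack_colorable\<close>. They agree along edges, since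
  a colour in \<open>L x\<close> but not in \<open>L y\<close> could be spent on \<open>x\<close>:
  the rest stays connected, and \<open>y\<close> loses a degree but no colour, which is slack.
  Connectedness spreads the equality to all of \<open>S\<close>.\<close>

lemma uncolorable_lists:
  assumes S: "biconnected E S"
    and L: "\<And>x. x \<in> S \<Longrightarrow> finite (L x)" "\<And>x. x \<in> S \<Longrightarrow> degree_in E S x \<le> card (L x)"
    and bad: "\<not> (\<exists>\<phi>. list_coloring E S L \<phi>)"
  shows "x \<in> S \<Longrightarrow> card (L x) = degree_in E S x"
    and "x \<in> S \<Longrightarrow> y \<in> S \<Longrightarrow> L x = L y"
proof -
  have fin: "finite S" and con: "connected_set E S"
    and con': "\<And>x. x \<in> S \<Longrightarrow> connected_set E (S - {x})"
    using S by (auto simp: biconnected_def)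
  show "x \<in> S \<Longrightarrow> card (L x) = degree_in E S x" for x
    using slack_colorable[OF fin con, of L x] L bad by force
  have sub: "L x \<subseteq> L y" if xy: "x \<in> S" "y \<in> S" "(x, y) \<in> E" for x y
  proof (rule ccontr)
    assume "\<not> ?thesis"
    then obtain c where c: "c \<in> L x" "c \<notin> L y" by blast
    define L' where "L' w = (if (x, w) \<in> E then L w - {c} else L w)" for w
    have deg: "degree_in E (S - {x}) w < degree_in E S w" if "w \<in> S" "(x, w) \<in> E" for w
      using xy that E_sym by (intro degree_in_less) auto
    have "\<exists>\<phi>. list_coloring E (S - {x}) L' \<phi>"
    proof (rule slack_colorable[where z = y])
      fix w assume w: "w \<in> S - {x}"
      then show "finite (L' w)" using L(1) by (auto simp: L'_def)
      have "degree_in E (S - {x}) w \<le> degree_in E S w" by (rule degree_in_mono) auto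
      then show "degree_in E (S - {x}) w \<le> card (L' w)"
        using w L(2)[of w] deg[of w] by (auto simp: L'_def card_Diff_singleton_if)
    next
      show "degree_in E (S - {x}) y < card (L' y)"
        using xy c L(2)[of y] deg[of y] by (simp add: L'_def)
    qed (use fin con' xy E_irrefl in auto)
    then obtain \<phi> where \<phi>: "list_coloring E (S - {x}) L' \<phi>" ..
    then have "list_coloring E (S - {x}) L \<phi>"
      unfolding list_coloring_def L'_def by (metis DiffD1)
    moreover have "\<phi> w \<noteq> c" if "w \<in> S" "(x, w) \<in> E" for w
    proof -
      have "w \<in> S - {x}" using that E_irrefl by blast
      then have "\<phi> w \<in> L' w" using \<phi> unfolding list_coloring_def by blast
      then show ?thesis using that(2) by (simp add: L'_def)
    qed
    ultimately have "list_coloring E S L (\<phi>(x := c))"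
      using c(1) by (intro list_coloring_extend) auto
    with bad show False by blast
  qed
  show "L x = L y" if "x \<in> S" "y \<in> S" for x y
  proof (rule ccontr)
    assume "L x \<noteq> L y"
    then have "{w \<in> S. L w = L x} \<subseteq> S" "{w \<in> S. L w = L x} \<noteq> {}" "{w \<in> S. L w = L x} \<noteq> S"
      using that by auto
    from connected_setD[OF con this] obtain a b
      where ab: "a \<in> {w \<in> S. L w = L x}" "b \<in> S" "b \<notin> {w \<in> S. L w = L x}" "(a, b) \<in> E" .
    then have "L a = L b" using sub[of a b] sub[of b a] E_sym[of a b] by blast
    with ab show False by simp
  qed
qed

lemma irregular_degree_choosable:
  assumes S: "biconnected E S" and "x \<in> S" "y \<in> S" "degree_in E S x \<noteq> degree_in E S y"
  shows "degree_choosable E S"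
  unfolding degree_choosable_def
proof (intro conjI allI impI)
  fix L :: "'a \<Rightarrow> nat set"
  assume L: "\<forall>x\<in>S. finite (L x) \<and> degree_in E S x \<le> card (L x)"
  show "\<exists>\<phi>. list_coloring E S L \<phi>"
  proof (rule ccontr)
    assume "\<not> ?thesis"
    note u = uncolorable_lists[OF S _ _ this]
    have "L x = L y" by (rule u(2)) (use L assms(2,3) in auto)
    moreover have "card (L w) = degree_in E S w" if "w \<in> S" for w
      by (rule u(1)) (use L that in auto)
    ultimately have "degree_in E S x = degree_in E S y" using assms(2,3) by metis
    with assms(4) show False by simp
  qed
qed (use S assms in \<open>auto simp: biconnected_def\<close>)

text \<open>In the only dangerous case all lists are equal and, by minimum degree 2, hold two
  colours, one for each side.\<close>

lemma bipartite_degree_choosable: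
  assumes S: "biconnected E S"
    and h: "\<And>x y. x \<in> S \<Longrightarrow> y \<in> S \<Longrightarrow> (x, y) \<in> E \<Longrightarrow> h x \<noteq> (h y :: bool)"
  shows "degree_choosable E S"
  unfolding degree_choosable_def
proof (intro conjI allI impI)
  show "S \<noteq> {}" "finite S" using S by (auto simp: biconnected_def)
  then obtain z where z: "z \<in> S" by blast
  fix L :: "'a \<Rightarrow> nat set"
  assume L: "\<forall>x\<in>S. finite (L x) \<and> degree_in E S x \<le> card (L x)"
  show "\<exists>\<phi>. list_coloring E S L \<phi>"
  proof (rule ccontr)
    assume bad: "\<not> ?thesis"
    note u = uncolorable_lists[OF S _ _ bad]
    have "2 \<le> card (L z)" using biconnected_degree_ge_2[OF S z] L z le_trans by blast
    then obtain a b where ab: "a \<in> L z" "b \<in> L z" "a \<noteq> b"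
      using L z card_le_Suc0_iff_eq[of "L z"] by fastforce
    have "L x = L z" if "x \<in> S" for x by (rule u(2)) (use L that z in auto)
    then have "list_coloring E S L (\<lambda>x. if h x then a else b)"
      using ab h unfolding list_coloring_def by auto
    with bad show False by blast
  qed
qed

end

section \<open>Ears, cycles and the clique-or-cycle dichotomy\<close>

context simple_graph
begin

text \<open>A connected set \<open>T\<close> outside a regular biconnected set \<open>M\<close> with at least two attachments
  on \<open>M\<close>, taken minimal, is an ear; adding it to \<open>M\<close> destroys regularity.\<close>

lemma regular_subset_degree_choosable:
  assumes S: "biconnected E S" and M: "biconnected E M" "M \<subseteq> S" "M \<noteq> S"
    and reg: "\<And>x. x \<in> M \<Longrightarrow> degree_in E M x = d"
    and ext: "\<And>q. q \<in> S \<Longrightarrow> q \<notin> M \<Longrightarrow> M \<subseteq> E `` {q} \<Longrightarrow> d + 1 \<noteq> card M"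
  obtains D where "D \<subseteq> S" "degree_choosable E D"
proof -
  have fS: "finite S" and fM: "finite M" and cM: "connected_set E M" and M3: "3 \<le> card M"
    using S M(1) by (auto simp: biconnected_def)
  define N where "N T = {m \<in> M. \<exists>t\<in>T. (t, m) \<in> E}" for T
  have fN: "finite (N T)" for T using fM by (simp add: N_def)
  define P where "P T \<longleftrightarrow> T \<subseteq> S - M \<and> T \<noteq> {} \<and> connected_set E T \<and> 2 \<le> card (N T)" for T
  have "\<exists>T. P T"
  proof -
    \<comment> \<open>Here \<open>T\<close> is taken largest, that is, as a component of
      \<open>S - M\<close>. With at most one attachment \<open>m\<close> it would be cut off from
      the rest of \<open>M\<close> when \<open>m\<close> is deleted from \<open>S\<close>.\<close>
    define Q where "Q T \<longleftrightarrow> T \<subseteq> S - M \<and> T \<noteq> {} \<and> connected_set E T" for T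
    obtain t where t: "t \<in> S - M" using M by blast
    then have "Q {t}" by (auto simp: Q_def)
    moreover have "\<forall>T. Q T \<longrightarrow> card T < Suc (card S)"
      using fS by (auto simp: Q_def less_Suc_eq_le intro!: card_mono)
    ultimately obtain T where T: "Q T" "\<And>T'. Q T' \<Longrightarrow> card T' \<le> card T"
      using ex_has_greatest_nat[of Q "{t}" card "Suc (card S)"] by metis
    have fT: "finite T" using T(1) fS unfolding Q_def by (meson finite_Diff finite_subset)
    have "2 \<le> card (N T)"
    proof (rule ccontr)
      assume "\<not> ?thesis"
      then have "card (N T) \<le> Suc 0" by simp
      then have *: "\<forall>a\<in>N T. \<forall>b\<in>N T. a = b" using card_le_Suc0_iff_eq[OF fN] by blast
      obtain m where m: "m \<in> M" "N T \<subseteq> {m}"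
      proof (cases "N T = {}")
        case True
        moreover obtain m where "m \<in> M" using M3 by fastforce
        ultimately show ?thesis using that by blast
      next
        case False
        then obtain m where "m \<in> N T" by blast
        with * that[of m] show ?thesis unfolding N_def by blast
      qed
      have "connected_set E (S - {m})" using S m M(2) unfolding biconnected_def by blast
      moreover have "T \<subseteq> S - {m}" "T \<noteq> {}" using T(1) m unfolding Q_def by auto
      moreover have "T \<noteq> S - {m}"
      proof
        assume "T = S - {m}"
        then have "M \<subseteq> {m}" using T(1) M(2) unfolding Q_def by blast
        then have "card M \<le> card {m}" by (intro card_mono) auto
        with M3 show False by simp
      qed
      ultimately obtain a b where ab: "a \<in> T" "b \<in> S - {m}" "b \<notin> T" "(a, b) \<in> E"
        using connected_setD by metis
      show False
      proof (cases "b \<in> M")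
        case True
        then have "b \<in> N T" using ab by (auto simp: N_def)
        with m ab show False by blast
      next
        case False
        have "connected_set E (insert b T)"
          using connected_set_insert ab T(1) unfolding Q_def by blast
        then have "Q (insert b T)" using T(1) ab False unfolding Q_def by blast
        from T(2)[OF this] ab fT show False by simp
      qed
    qed
    with T(1) show ?thesis unfolding P_def Q_def by blast
  qed
  then obtain T0 where "P T0" ..
  from ex_least_card[of P, OF this] obtain T
    where T: "P T" and min: "\<And>T'. P T' \<Longrightarrow> card T \<le> card T'" by blast
  have fT: "finite T" and cT: "connected_set E T" and TM: "M \<inter> T = {}" and TS: "T \<subseteq> S"
    and T0: "T \<noteq> {}" and NT: "2 \<le> card (N T)"
    using T fS unfolding P_def by (auto intro: finite_subset)
  have small: "card (N T') < 2" if "T' \<subset> T" "connected_set E T'" "T' \<noteq> {}" for T'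
  proof (rule ccontr)
    assume "\<not> ?thesis"
    then have "P T'" using that T unfolding P_def by auto
    from min[OF this] psubset_card_mono[OF fT that(1)] show False by simp
  qed
  have con: "connected_set E ((M - {x}) \<union> T)" for x
  proof -
    have cMx: "connected_set E (M - {x})"
      using M(1) unfolding biconnected_def by (cases "x \<in> M") auto
    have "\<not> N T \<subseteq> {x}"
    proof
      assume "N T \<subseteq> {x}"
      then have "card (N T) \<le> card {x}" by (intro card_mono) auto
      with NT show False by simp
    qed
    then obtain m t where "m \<in> M - {x}" "t \<in> T" "(t, m) \<in> E" unfolding N_def by blast
    then show ?thesis using connected_set_Un_edge[OF cMx cT] E_sym by blast
  qed
  have bi: "biconnected E (M \<union> T)"
    unfolding biconnected_def
  proof (intro conjI ballI)
    show "finite (M \<union> T)" using fM fT by simp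
    show "3 \<le> card (M \<union> T)" using M3 card_mono[of "M \<union> T" M] fM fT by simp
    obtain t where "t \<in> T" using T0 by blast
    then have "M - {t} = M" using TM by blast
    then show "connected_set E (M \<union> T)" using con[of t] by simp
    fix x assume x: "x \<in> M \<union> T"
    show "connected_set E (M \<union> T - {x})"
    proof (cases "x \<in> M")
      case True
      then have "M \<union> T - {x} = (M - {x}) \<union> T" using TM by blast
      then show ?thesis using con[of x] by simp
    next
      case False
      then have xT: "x \<in> T" using x by simp
      have "M \<noteq> {}" using M3 by auto
      have "connected_set E (M \<union> (T - {x}))"
      proof (rule connected_set_attach[OF cM \<open>M \<noteq> {}\<close> cT TM xT])
        fix A assume A: "A \<subseteq> T - {x}" "A \<noteq> {}" "connected_set E (T - A)"
        show "\<exists>y\<in>A. \<exists>z\<in>M. (y, z) \<in> E"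
        proof (rule ccontr)
          assume "\<not> ?thesis"
          then have "N (T - A) = N T" unfolding N_def by blast
          moreover have "T - A \<subset> T" "T - A \<noteq> {}" using A xT by auto
          ultimately show False using small[of "T - A"] A(3) NT by simp
        qed
      qed
      moreover have "M \<union> T - {x} = M \<union> (T - {x})" using False by blast
      ultimately show ?thesis by simp
    qed
  qed
  have big: "d < degree_in E (M \<union> T) m" if m: "m \<in> N T" for m
  proof -
    obtain t where "t \<in> T" "(m, t) \<in> E" "m \<in> M" using m E_sym unfolding N_def by blast
    with degree_in_less[of M "M \<union> T" m t] reg[of m] TM show ?thesis by auto
  qed
  obtain m where m: "m \<in> N T" using NT by fastforce
  \<comment> \<open>Vertices of \<open>N T\<close> gain degree, while a vertex of \<open>M\<close>
    outside \<open>N T\<close> keeps degree \<open>d\<close>. If all of \<open>M\<close> is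
    attached, \<open>T\<close> is a single vertex \<open>q\<close>: otherwise removing a non-cut
    vertex splits \<open>T\<close> into two smaller connected sets with at most one attachment each,
    too few for \<open>M\<close>. Then \<open>q\<close> has degree \<open>card M\<close> and the
    vertices of \<open>M\<close> have degree \<open>d + 1\<close>, which \<open>ext\<close> keeps
    apart.\<close>
  have "\<exists>x\<in>M \<union> T. \<exists>y\<in>M \<union> T. degree_in E (M \<union> T) x \<noteq> degree_in E (M \<union> T) y"
  proof (cases "N T = M")
    case False
    then obtain m' where m': "m' \<in> M" "m' \<notin> N T" unfolding N_def by blast
    have "E `` {m'} \<inter> (M \<union> T) = E `` {m'} \<inter> M"
      using m' E_sym unfolding N_def by blast
    then have "degree_in E (M \<union> T) m' = d" using reg[OF m'(1)] by (simp add: degree_in_def)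
    with big[OF m] m m'(1) show ?thesis unfolding N_def by (metis (mono_tags, lifting) UnI1 mem_Collect_eq nat_neq_iff)
  next
    case True
    obtain q where q: "q \<in> T" using T0 by blast
    have "T = {q}"
    proof (rule ccontr)
      assume "T \<noteq> {q}"
      from ex_noncut[OF fT cT q this] obtain x where x: "x \<in> T" "x \<noteq> q" "connected_set E (T - {x})" .
      have "card (N (T - {x})) < 2" using x q by (intro small) auto
      moreover have "card (N {x}) < 2" using x q by (intro small) auto
      moreover have "N T = N (T - {x}) \<union> N {x}" using x(1) unfolding N_def by blast
      ultimately have "card (N T) \<le> 2" using card_Un_le[of "N (T - {x})" "N {x}"] by simp
      with True M3 show False by simp
    qed
    then have Mq: "M \<subseteq> E `` {q}" using True unfolding N_def by blast
    have "E `` {q} \<inter> (M \<union> T) = M" using Mq \<open>T = {q}\<close> E_irrefl by blast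
    then have dq: "degree_in E (M \<union> T) q = card M" by (simp add: degree_in_def)
    have mM: "m \<in> M" using m by (simp add: N_def)
    have "E `` {m} \<inter> (M \<union> T) = insert q (E `` {m} \<inter> M)"
      using Mq \<open>T = {q}\<close> mM E_sym[of q m] by blast
    moreover have "q \<notin> E `` {m} \<inter> M" using q TM by blast
    ultimately have "degree_in E (M \<union> T) m = d + 1"
      using reg[OF mM] by (simp add: degree_in_def)
    moreover have "d + 1 \<noteq> card M" using ext[of q] q TS TM Mq by blast
    ultimately show ?thesis using dq mM q by (metis UnI1 UnI2)
  qed
  then have "degree_choosable E (M \<union> T)" using irregular_degree_choosable[OF bi] by blast
  with that[of "M \<union> T"] M(2) TS show ?thesis by blast
qed

text \<open>The set is smallest among the connected sets with two neighbours of \<open>u\<close>,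
  neither of them prescribed. Deleting a non-cut vertex therefore leaves at most one neighbour, so
  \<open>u\<close> has exactly two.\<close>

lemma ex_cycle_through:
  assumes S: "connected_set E S" "finite S" "u \<notin> S" and deg: "2 \<le> degree_in E S u"
  obtains M where "M \<subseteq> insert u S" "u \<in> M" "biconnected E M" "degree_in E M u = 2"
proof -
  define P where "P T \<longleftrightarrow> T \<subseteq> S \<and> connected_set E T \<and> 2 \<le> degree_in E T u" for T
  have "P S" using S deg by (simp add: P_def)
  from ex_least_card[of P, OF this] obtain T
    where T: "P T" and min: "\<And>T'. P T' \<Longrightarrow> card T \<le> card T'" by blast
  have fT: "finite T" and cT: "connected_set E T" and uT: "u \<notin> T" and dT: "2 \<le> degree_in E T u"
    using T S unfolding P_def by (auto intro: finite_subset)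
  have small: "degree_in E T' u < 2" if "T' \<subset> T" "connected_set E T'" for T'
  proof (rule ccontr)
    assume "\<not> ?thesis"
    then have "P T'" using that T unfolding P_def by auto
    from min[OF this] psubset_card_mono[OF fT that(1)] show False by simp
  qed
  have "E `` {u} \<inter> T \<noteq> {}" using dT unfolding degree_in_def by fastforce
  then obtain t where t: "t \<in> T" "(u, t) \<in> E" by blast
  have T2: "2 \<le> card T" using dT fT card_mono[of T "E `` {u} \<inter> T"] unfolding degree_in_def by auto
  have "biconnected E (insert u T)"
    unfolding biconnected_def
  proof (intro conjI ballI)
    show "connected_set E (insert u T)"
      using connected_set_insert[OF cT t(1)] E_sym t(2) by blast
    show "3 \<le> card (insert u T)" using T2 uT fT by simp
    fix x assume "x \<in> insert u T"
    show "connected_set E (insert u T - {x})"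
    proof (cases "x = u")
      case True
      then show ?thesis using cT uT by simp
    next
      case False
      then have xT: "x \<in> T" using \<open>x \<in> insert u T\<close> by simp
      have "connected_set E ({u} \<union> (T - {x}))"
      proof (rule connected_set_attach[OF _ _ cT _ xT])
        fix A assume A: "A \<subseteq> T - {x}" "A \<noteq> {}" "connected_set E (T - A)"
        show "\<exists>y\<in>A. \<exists>z\<in>{u}. (y, z) \<in> E"
        proof (rule ccontr)
          assume "\<not> ?thesis"
          then have "E `` {u} \<inter> (T - A) = E `` {u} \<inter> T" using E_sym by blast
          then show False using small[of "T - A"] A dT unfolding degree_in_def by auto
        qed
      qed (use uT in auto)
      moreover have "insert u T - {x} = {u} \<union> (T - {x})" using False by blast
      ultimately show ?thesis by simp
    qed
  qed (use fT in auto)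
  moreover have "degree_in E (insert u T) u = 2"
  proof -
    have eq: "degree_in E (insert u T) u = degree_in E T u"
      using E_irrefl unfolding degree_in_def by (metis Int_insert_right_if0 Image_singleton_iff)
    have "T \<noteq> {t}" using T2 by auto
    from ex_noncut[OF fT cT t(1) this] obtain x where x: "x \<in> T" "connected_set E (T - {x})" by blast
    have "degree_in E (T - {x}) u < 2" using x by (intro small) auto
    moreover have "card (E `` {u} \<inter> T) \<le> card (insert x (E `` {u} \<inter> (T - {x})))"
      by (intro card_mono) auto
    then have "degree_in E T u \<le> Suc (degree_in E (T - {x}) u)"
      by (simp add: degree_in_def)
    ultimately show ?thesis using dT eq by simp
  qed
  ultimately show ?thesis using that[of "insert u T"] T unfolding P_def by blast
qed

text \<open>A cycle \<open>M\<close> through \<open>u\<close> is regular of degree 2, as it is not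
  choosable. If it is not all of \<open>S\<close>, the ear argument fails only for
  \<open>card M = 3\<close>, so \<open>M\<close> is a triangle. Extend it to a largest clique
  \<open>Q\<close>: no outside vertex is joined to all of \<open>Q\<close>, so the ear argument
  applies unless \<open>Q = S\<close>.\<close>

lemma biconnected_structure:
  assumes S: "biconnected E S" and none: "\<And>D. D \<subseteq> S \<Longrightarrow> \<not> degree_choosable E D"
  shows "clique E S \<or> (\<forall>x\<in>S. degree_in E S x = 2)"
proof -
  have fS: "finite S" and S3: "3 \<le> card S" using S by (auto simp: biconnected_def)
  obtain u where u: "u \<in> S" using S3 by fastforce
  have "E `` {u} \<inter> (S - {u}) = E `` {u} \<inter> S" using E_irrefl by blast
  then have "2 \<le> degree_in E (S - {u}) u"
    using biconnected_degree_ge_2[OF S u] by (simp add: degree_in_def)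
  from ex_cycle_through[OF _ _ _ this] S u fS obtain M
    where M: "M \<subseteq> insert u (S - {u})" "u \<in> M" "biconnected E M" "degree_in E M u = 2"
    unfolding biconnected_def by blast
  have MS: "M \<subseteq> S" using M(1) u by blast
  have reg: "degree_in E M x = 2" if "x \<in> M" for x
    using irregular_degree_choosable[OF M(3) that M(2)] none[OF MS] M(4) by auto
  have fM: "finite M" and M3: "3 \<le> card M" using M by (auto simp: biconnected_def)
  show ?thesis
  proof (cases "M = S")
    case True
    then show ?thesis using reg by blast
  next
    case False
    have card3: "card M = 3"
    proof (rule ccontr)
      assume "card M \<noteq> 3"
      then show False
        using regular_subset_degree_choosable[OF S M(3) MS False, of 2] reg none by auto
    qed
    have "clique E M"
      unfolding clique_def
    proof (intro ballI impI)
      fix x y assume xy: "x \<in> M" "y \<in> M" "x \<noteq> y"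
      have "E `` {x} \<inter> M = M - {x}"
      proof (rule card_subset_eq)
        show "E `` {x} \<inter> M \<subseteq> M - {x}" using E_irrefl by blast
        show "card (E `` {x} \<inter> M) = card (M - {x})"
          using reg[OF xy(1)] card3 fM xy(1) by (simp add: degree_in_def)
      qed (use fM in auto)
      with xy show "(x, y) \<in> E" by blast
    qed
    define P where "P Q \<longleftrightarrow> M \<subseteq> Q \<and> Q \<subseteq> S \<and> clique E Q" for Q
    have "P M" using MS \<open>clique E M\<close> by (simp add: P_def)
    moreover have "\<forall>Q. P Q \<longrightarrow> card Q < Suc (card S)"
      using fS by (auto simp: P_def less_Suc_eq_le intro!: card_mono)
    ultimately obtain Q where Q: "P Q" "\<And>Q'. P Q' \<Longrightarrow> card Q' \<le> card Q"
      using ex_has_greatest_nat[of P M card "Suc (card S)"] by metis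
    have fQ: "finite Q" using Q(1) fS finite_subset unfolding P_def by blast
    have Q3: "3 \<le> card Q" using M3 Q(1) card_mono[OF fQ, of M] unfolding P_def by simp
    have clQ: "clique E Q" using Q(1) by (simp add: P_def)
    show ?thesis
    proof (cases "Q = S")
      case True
      then show ?thesis using clQ by blast
    next
      case False
      have "\<not> Q \<subseteq> E `` {q}" if q: "q \<in> S" "q \<notin> Q" for q
      proof
        assume "Q \<subseteq> E `` {q}"
        then have "clique E (insert q Q)" using clQ E_sym unfolding clique_def by blast
        then have "P (insert q Q)" using Q(1) q unfolding P_def by blast
        from Q(2)[OF this] q fQ show False by simp
      qed
      with regular_subset_degree_choosable[OF S clique_biconnected[OF clQ fQ Q3] _ False, of "card Q - 1"]
        clique_degree_in[OF clQ _ fQ] Q(1) none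
      show ?thesis unfolding P_def by metis
    qed
  qed
qed

end

subsection \<open>Balls without cores grow exponentially\<close>

primrec nball :: "('a \<times> 'a) set \<Rightarrow> 'a \<Rightarrow> nat \<Rightarrow> 'a set" where
  "nball E v 0 = {v}"
| "nball E v (Suc r) = nball E v r \<union> E `` nball E v r"

definition layer :: "('a \<times> 'a) set \<Rightarrow> 'a \<Rightarrow> nat \<Rightarrow> 'a set" where
  "layer E v i = nball E v i - (\<Union>j<i. nball E v j)"

lemma nball_mono: "r \<le> s \<Longrightarrow> nball E v r \<subseteq> nball E v s"
  by (induction rule: dec_induct) auto

lemma nball_center [simp, intro]: "v \<in> nball E v r"
  using nball_mono[of 0 r E v] by simp

lemma nball_step: "x \<in> nball E v r \<Longrightarrow> (x, y) \<in> E \<Longrightarrow> y \<in> nball E v (Suc r)"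
  by auto

lemma nball_trans: "y \<in> nball E x r \<Longrightarrow> z \<in> nball E y s \<Longrightarrow> z \<in> nball E x (r + s)"
  by (induction s arbitrary: z) auto

text \<open>The recursion of \<open>nball\<close> extends at the far end; this is the expansion at
  the near end, for inductions that move the centre.\<close>

lemma nball_Suc_front: "nball E x (Suc r) = {x} \<union> (\<Union>y\<in>E `` {x}. nball E y r)"
proof (induction r)
  case (Suc r)
  have "nball E x (Suc (Suc r)) = nball E x (Suc r) \<union> E `` nball E x (Suc r)" by simp
  also have "\<dots> = {x} \<union> (\<Union>y\<in>E `` {x}. nball E y (Suc r))"
    unfolding Suc.IH by auto
  finally show ?case .
qed auto

declare nball.simps(2) [simp del]

lemma layer_disjoint: "x \<in> layer E v i \<Longrightarrow> x \<in> layer E v j \<Longrightarrow> i = j"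
  unfolding layer_def by (metis DiffD1 DiffD2 UN_iff lessThan_iff linorder_neqE_nat)

lemma layer_distinct: "x \<in> layer E v i \<Longrightarrow> y \<in> layer E v j \<Longrightarrow> i \<noteq> j \<Longrightarrow> x \<noteq> y"
  using layer_disjoint by metis

lemma layer_in_nball: "x \<in> layer E v i \<Longrightarrow> x \<in> nball E v i"
  by (auto simp: layer_def)

lemma nball_layer:
  assumes "x \<in> nball E v r"
  obtains i where "i \<le> r" "x \<in> layer E v i"
proof -
  define i where "i = (LEAST i. x \<in> nball E v i)"
  have "x \<in> nball E v i" "i \<le> r" unfolding i_def using assms by (rule LeastI, rule Least_le)
  moreover have "x \<notin> nball E v j" if "j < i" for j using that not_less_Least unfolding i_def by blast
  ultimately show ?thesis using that[of i] unfolding layer_def by blast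
qed

lemma layer_0 [simp]: "layer E v 0 = {v}"
  by (simp add: layer_def)

lemma layer_notin_nball: "x \<in> layer E v i \<Longrightarrow> j < i \<Longrightarrow> x \<notin> nball E v j"
  by (auto simp: layer_def)

lemma layer_parent:
  assumes "x \<in> layer E v (Suc i)"
  obtains p where "p \<in> layer E v i" "(p, x) \<in> E"
proof -
  have "x \<in> nball E v (Suc i)" "x \<notin> nball E v i" using assms by (auto simp: layer_def)
  then obtain p where p: "p \<in> nball E v i" "(p, x) \<in> E" by (auto simp: nball.simps)
  have "p \<notin> nball E v j" if "j < i" for j
    using layer_notin_nball[OF assms, of "Suc j"] nball_step[OF _ p(2), of v j] that by auto
  with p that[of p] show ?thesis unfolding layer_def by blast
qed

lemma layer_edge:
  assumes "(x, y) \<in> E" "x \<in> layer E v i" "y \<in> layer E v j"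
  shows "j \<le> Suc i"
proof (rule ccontr)
  assume "\<not> ?thesis"
  then have "y \<notin> nball E v (Suc i)" using layer_notin_nball[OF assms(3)] by simp
  then show False using nball_step[OF layer_in_nball[OF assms(2)] assms(1)] by blast
qed

context simple_graph
begin

lemma nball_sym: "y \<in> nball E x r \<Longrightarrow> x \<in> nball E y r"
proof (induction r arbitrary: x)
  case (Suc r)
  then consider "y = x" | z where "(x, z) \<in> E" "y \<in> nball E z r"
    unfolding nball_Suc_front by blast
  then show ?case
  proof cases
    case 2
    show ?thesis by (rule nball_step[OF Suc.IH[OF 2(2)] E_sym[OF 2(1)]])
  qed auto
qed auto

lemma finite_nball [simp]: "finite (nball E v r)"
proof (induction r)
  case (Suc r)
  have "E `` nball E v r = (\<Union>x\<in>nball E v r. E `` {x})" by blast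
  then show ?case using Suc finite_neighbours by (simp add: nball.simps)
qed simp

lemma connected_nball: "connected_set E (nball E v r)"
proof (induction r)
  case (Suc r)
  show ?case
    unfolding connected_set_def
  proof (intro allI impI)
    fix A assume A: "A \<subseteq> nball E v (Suc r)" "A \<noteq> {}" "A \<noteq> nball E v (Suc r)"
    let ?B = "nball E v r"
    consider "A \<inter> ?B = {}" | "?B \<subseteq> A" | "A \<inter> ?B \<noteq> {}" "A \<inter> ?B \<noteq> ?B" by blast
    then show "\<exists>x\<in>A. \<exists>y\<in>nball E v (Suc r) - A. (x, y) \<in> E"
    proof cases
      case 1
      obtain a where "a \<in> A" using A(2) by blast
      then obtain b where "b \<in> ?B" "(b, a) \<in> E" using A(1) 1 by (auto simp: nball.simps)
      moreover have "b \<in> nball E v (Suc r) - A" using 1 \<open>b \<in> ?B\<close> nball_mono[of r "Suc r" E v] by auto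
      ultimately show ?thesis using \<open>a \<in> A\<close> E_sym[of b a] by blast
    next
      case 2
      obtain a where "a \<in> nball E v (Suc r) - A" using A by blast
      then obtain b where "b \<in> ?B" "(b, a) \<in> E" using 2 by (auto simp: nball.simps)
      with 2 \<open>a \<in> _\<close> show ?thesis by (intro bexI[of _ b] bexI[of _ a]) auto
    next
      case 3
      from connected_setD[OF Suc.IH, of "A \<inter> ?B"] 3 show ?thesis by (auto simp: nball.simps)
    qed
  qed
qed simp

lemma finite_layer [simp]: "finite (layer E v i)"
  by (simp add: layer_def)

text \<open>Both ends of an edge inside a layer are joined to the connected ball below, so the edge
  closes a cycle that otherwise stays below and can be routed through a prescribed parent
  \<open>q\<close> of \<open>x\<close>.\<close>

lemma ex_horizontal_cycle:
  assumes "x \<in> layer E v (Suc j)" "y \<in> layer E v (Suc j)" "(x, y) \<in> E" "q \<in> layer E v j" "(q, x) \<in> E"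
  obtains C where "biconnected E C" "C \<subseteq> {x, y} \<union> nball E v j" "x \<in> C" "y \<in> C" "q \<in> C"
proof -
  from layer_parent[OF assms(2)] obtain q' where q': "q' \<in> layer E v j" "(q', y) \<in> E" .
  let ?X = "insert y (nball E v j)"
  have "connected_set E ?X"
    using connected_set_insert[OF connected_nball layer_in_nball[OF q'(1)] q'(2)] .
  moreover have "x \<notin> ?X"
    using layer_notin_nball[OF assms(1), of j] assms(3) E_irrefl by auto
  moreover have "q \<in> ?X" "q \<noteq> y"
    using layer_in_nball[OF assms(4)] layer_notin_nball[OF assms(2), of j] by auto
  ultimately show ?thesis
    using ex_biconnected_through[of ?X x q y] E_sym[OF assms(5)] assms(3) that by auto
qed

end

section \<open>Breadth-first layers of a ball without cores\<close>

locale ball_without_core = simple_graph +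
  fixes v :: 'a and R \<Delta> :: nat
  assumes Delta: "3 \<le> \<Delta>"
    and regular: "x \<in> nball E v R \<Longrightarrow> card (E `` {x}) = \<Delta>"
    and none: "D \<subseteq> nball E v R \<Longrightarrow> \<not> degree_choosable E D"
    and no_clique: "card Q = \<Delta> + 1 \<Longrightarrow> \<not> clique E Q"
begin

lemma layer_in: "x \<in> layer E v i \<Longrightarrow> i \<le> R \<Longrightarrow> x \<in> nball E v R"
  using layer_in_nball nball_mono by fast

lemma two_regular:
  assumes "biconnected E C" "C \<subseteq> nball E v R" "a \<in> C" "b \<in> C" "a \<noteq> b" "(a, b) \<notin> E" "x \<in> C"
  shows "degree_in E C x = 2"
  using biconnected_structure[OF assms(1)] none assms unfolding clique_def by (meson subset_trans)

lemma no_three_neighbours: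
  assumes C: "biconnected E C" "C \<subseteq> nball E v R" "a \<in> C" "b \<in> C" "a \<noteq> b" "(a, b) \<notin> E"
    and u: "u \<in> C" "{x, y, z} \<subseteq> C" "{x, y, z} \<subseteq> E `` {u}" "x \<noteq> y" "x \<noteq> z" "y \<noteq> z"
  shows False
proof -
  have "card {x, y, z} \<le> degree_in E C u"
    unfolding degree_in_def using u by (intro card_mono) auto
  moreover have "card {x, y, z} = 3" using u by simp
  ultimately show False using two_regular[OF C u(1)] by simp
qed

text \<open>Two parents would close an even cycle: a cycle without horizontal edges is bipartite, and
  one with a horizontal edge is joined to a second cycle below it.\<close>

lemma unique_parent:
  assumes u: "u \<in> layer E v (Suc i)" "Suc i \<le> R"
    and p: "p \<in> layer E v i" "(p, u) \<in> E" and p': "p' \<in> layer E v i" "(p', u) \<in> E"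
  shows "p = p'"
proof (rule ccontr)
  assume "p \<noteq> p'"
  have un: "u \<notin> nball E v i" using layer_notin_nball[OF u(1)] by simp
  have "p \<in> nball E v i" "p' \<in> nball E v i" using p(1) p'(1) by (auto dest: layer_in_nball)
  from ex_biconnected_through[OF connected_nball finite_nball un this \<open>p \<noteq> p'\<close>
      E_sym[OF p(2)] E_sym[OF p'(2)]]
  obtain C where C: "biconnected E C" "C \<subseteq> insert u (nball E v i)" "u \<in> C" .
  have iR: "nball E v i \<subseteq> nball E v R" using u(2) by (intro nball_mono) simp
  then have CR: "C \<subseteq> nball E v R" using C(2) layer_in[OF u] by blast
  define lay where "lay x = (THE j. x \<in> layer E v j)" for x
  have lay: "lay x = j" if "x \<in> layer E v j" for x j
    unfolding lay_def by (rule the_equality) (rule that, rule layer_disjoint[OF _ that])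
  show False
  proof (cases "\<exists>x\<in>C. \<exists>y\<in>C. (x, y) \<in> E \<and> lay x = lay y")
    case False
    have "even (lay x) \<noteq> even (lay y)" if xy: "x \<in> C" "y \<in> C" "(x, y) \<in> E" for x y
    proof -
      obtain a where a: "x \<in> layer E v a" using nball_layer[of x E v R] xy(1) CR by blast
      obtain b where b: "y \<in> layer E v b" using nball_layer[of y E v R] xy(2) CR by blast
      have "b \<le> Suc a" "a \<le> Suc b"
        using layer_edge[OF xy(3) a b] layer_edge[OF E_sym[OF xy(3)] b a] by auto
      moreover have "a \<noteq> b" using False xy lay[OF a] lay[OF b] by metis
      ultimately have "b = Suc a \<or> a = Suc b" by linarith
      then show ?thesis using lay[OF a] lay[OF b] by auto
    qed
    then have "degree_choosable E C" using bipartite_degree_choosable[OF C(1), of "\<lambda>x. even (lay x)"] by blast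
    with none[OF CR] show False by blast
  next
    case True
    then obtain x y where xy: "x \<in> C" "y \<in> C" "(x, y) \<in> E" "lay x = lay y" by blast
    obtain a where a: "x \<in> layer E v a" using nball_layer[of x E v R] xy(1) CR by blast
    obtain b where b: "y \<in> layer E v b" using nball_layer[of y E v R] xy(2) CR by blast
    have ab: "b = a" using lay[OF a] lay[OF b] xy(4) by simp
    have "x \<noteq> y" using xy(3) E_irrefl by blast
    then have "a \<noteq> 0" using a b ab by (metis layer_0 singletonD)
    then obtain j where j: "a = Suc j" using not0_implies_Suc by blast
    \<comment> \<open>\<open>u\<close> is the only vertex of \<open>C\<close> outside
      \<open>nball E v i\<close>, so both ends of the horizontal edge lie in lower layers.\<close>
    have "\<not> Suc i \<le> a"
    proof
      assume "Suc i \<le> a"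
      have "z = u" if "z \<in> C" "z \<in> layer E v a" for z
        using C(2) that layer_notin_nball[OF that(2), of i] \<open>Suc i \<le> a\<close> by auto
      with xy(1,2) a b ab \<open>x \<noteq> y\<close> show False by metis
    qed
    then have ji: "Suc j \<le> i" using j by simp
    obtain q where q: "q \<in> layer E v j" "(q, x) \<in> E" using layer_parent[of x E v j] a j by blast
    from ex_horizontal_cycle[of x v j y q] a b ab j q xy(3) obtain C3
      where C3: "biconnected E C3" "C3 \<subseteq> {x, y} \<union> nball E v j" "x \<in> C3" "y \<in> C3" "q \<in> C3" by auto
    have C3i: "C3 \<subseteq> nball E v i"
    proof -
      have "nball E v j \<subseteq> nball E v i" "nball E v a \<subseteq> nball E v i"
        using ji j by (auto intro!: nball_mono)
      moreover have "x \<in> nball E v a" "y \<in> nball E v a" using a b ab by (auto dest: layer_in_nball)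
      ultimately show ?thesis using C3(2) by blast
    qed
    have bi: "biconnected E (C \<union> C3)"
      using biconnected_Un[OF C(1) C3(1) _ _ \<open>x \<noteq> y\<close>] xy C3 by blast
    have U: "C \<union> C3 \<subseteq> nball E v R" using CR C3i iR by blast
    \<comment> \<open>\<open>q\<close> lies at least two layers below \<open>u\<close>: a
      nonadjacent pair, which makes the union 2-regular.\<close>
    have "q \<noteq> u" using C3(5) C3i un by blast
    moreover have "(u, q) \<notin> E" using layer_edge[OF E_sym q(1) u(1), of ] ji by auto
    ultimately have two: "degree_in E (C \<union> C3) z = 2" if "z \<in> C \<union> C3" for z
      using two_regular[OF bi U _ _ _ _ that, of u q] C(3) C3(5) by blast
    \<comment> \<open>The union is connected, so some vertex of \<open>C3\<close> has a neighbour
      outside \<open>C3\<close>, in addition to its two inside.\<close>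
    have "C3 \<noteq> C \<union> C3" using C(3) C3i un by blast
    then obtain s t where st: "s \<in> C3" "t \<in> C \<union> C3" "t \<notin> C3" "(s, t) \<in> E"
      using connected_setD[of E "C \<union> C3" C3] bi C3(3) unfolding biconnected_def by blast
    have "degree_in E C3 s < degree_in E (C \<union> C3) s" using st by (intro degree_in_less) auto
    with two[of s] st(1) biconnected_degree_ge_2[OF C3(1) st(1)] show False by simp
  qed
qed

text \<open>The two horizontal cycles share \<open>u\<close> and its parent \<open>p\<close>. Their
  union contains the nonadjacent pair \<open>p\<close>, \<open>s\<close>, while \<open>u\<close>
  would have the three neighbours \<open>p\<close>, \<open>s\<close>, \<open>s'\<close>.\<close>

lemma only_sibling:
  assumes u: "u \<in> layer E v (Suc i)" "Suc i \<le> R" and p: "p \<in> layer E v i" "(p, u) \<in> E"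
    and s: "s \<in> layer E v (Suc i)" "(u, s) \<in> E" "(p, s) \<notin> E"
    and s': "s' \<in> layer E v (Suc i)" "(u, s') \<in> E"
  shows "s' = s"
proof (rule ccontr)
  assume "s' \<noteq> s"
  from ex_horizontal_cycle[OF u(1) s(1,2) p] obtain C1
    where C1: "biconnected E C1" "C1 \<subseteq> {u, s} \<union> nball E v i" "u \<in> C1" "s \<in> C1" "p \<in> C1" .
  from ex_horizontal_cycle[OF u(1) s' p] obtain C2
    where C2: "biconnected E C2" "C2 \<subseteq> {u, s'} \<union> nball E v i" "u \<in> C2" "s' \<in> C2" "p \<in> C2" .
  have ne: "p \<noteq> u" "p \<noteq> s" "p \<noteq> s'"
    by (rule layer_distinct[OF p(1)], rule u s s', simp)+
  have bi: "biconnected E (C1 \<union> C2)"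
    using biconnected_Un[OF C1(1) C2(1), of u p] C1 C2 ne by blast
  have "nball E v i \<subseteq> nball E v R" using u(2) by (intro nball_mono) simp
  then have "C1 \<union> C2 \<subseteq> nball E v R"
    using C1(2) C2(2) u s(1) s'(1) layer_in by blast
  from no_three_neighbours[OF bi this, of p s u p s s'] C1 C2 ne s s' p E_sym \<open>s' \<noteq> s\<close>
  show False by blast
qed

lemma neighbour_layers:
  assumes "u \<in> layer E v (Suc i)"
  shows "E `` {u} = (E `` {u} \<inter> layer E v i) \<union> (E `` {u} \<inter> layer E v (Suc i)) \<union>
    (E `` {u} \<inter> layer E v (Suc (Suc i)))"
proof -
  have "y \<in> layer E v i \<union> layer E v (Suc i) \<union> layer E v (Suc (Suc i))" if y: "(u, y) \<in> E" for y
  proof -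
    have "y \<in> nball E v (Suc (Suc i))" using nball_step[OF layer_in_nball[OF assms] y] .
    then obtain j where j: "j \<le> Suc (Suc i)" "y \<in> layer E v j" by (rule nball_layer)
    have "Suc i \<le> Suc j" using layer_edge[OF E_sym[OF y] j(2) assms] .
    then have "j = i \<or> j = Suc i \<or> j = Suc (Suc i)" using j(1) by linarith
    then show ?thesis using j(2) by auto
  qed
  then show ?thesis by blast
qed

text \<open>Otherwise a cycle through \<open>u\<close>, \<open>w\<close> and a neighbour
  \<open>w'\<close> in the layer of \<open>w\<close> leaves \<open>u\<close> by a second neighbour
  \<open>z\<close>, in the layer of \<open>u\<close> or above it. Glued along \<open>u\<close> and
  \<open>z\<close> to a horizontal cycle at \<open>u\<close>, it gives \<open>u\<close> the three
  neighbours \<open>w\<close>, \<open>p\<close>, \<open>s\<close>. The nonadjacent pair is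
  \<open>u\<close>, \<open>w'\<close>, since \<open>w\<close> is the only child.\<close>

lemma only_child_no_sibling:
  assumes u: "u \<in> layer E v (Suc i)" and R: "Suc (Suc i) \<le> R"
    and w: "E `` {u} \<inter> layer E v (Suc (Suc i)) = {w}"
    and u': "u' \<in> layer E v (Suc i)" "(u, u') \<in> E"
  shows "E `` {w} \<inter> layer E v (Suc (Suc i)) = {}"
proof (rule ccontr)
  assume "\<not> ?thesis"
  then obtain w' where w': "w' \<in> layer E v (Suc (Suc i))" "(w, w') \<in> E" by blast
  have wl: "w \<in> layer E v (Suc (Suc i))" "(u, w) \<in> E" using w by auto
  have "w' \<noteq> w" using w' E_irrefl by blast
  then have nw': "(u, w') \<notin> E" using w w'(1) by blast
  from ex_horizontal_cycle[OF wl(1) w'(1,2) u wl(2)] obtain C1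
    where C1: "biconnected E C1" "C1 \<subseteq> {w, w'} \<union> nball E v (Suc i)" "w \<in> C1" "w' \<in> C1" "u \<in> C1" .
  have "\<not> E `` {u} \<inter> C1 \<subseteq> {w}"
  proof
    assume "E `` {u} \<inter> C1 \<subseteq> {w}"
    then have "card (E `` {u} \<inter> C1) \<le> card {w}" by (intro card_mono) auto
    then show False using biconnected_degree_ge_2[OF C1(1,5)] by (simp add: degree_in_def)
  qed
  then obtain z where z: "z \<in> C1" "(u, z) \<in> E" "z \<noteq> w" by blast
  obtain p where p: "p \<in> layer E v i" "(p, u) \<in> E" by (rule layer_parent[OF u])
  have "z \<notin> layer E v (Suc (Suc i))" using w z by blast
  then have zl: "z \<in> layer E v i \<or> z \<in> layer E v (Suc i)"
    using neighbour_layers[OF u] z(2) by blast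
  \<comment> \<open>The second cycle has to contain \<open>z\<close>. If \<open>z\<close> is the
    parent, any neighbour in the layer serves, so \<open>u'\<close> is taken; otherwise
    \<open>z\<close> itself.\<close>
  have "\<exists>s. s \<in> layer E v (Suc i) \<and> (u, s) \<in> E \<and> (z = p \<or> z = s)"
  proof (cases "z \<in> layer E v i")
    case True
    then have "z = p" using unique_parent[OF u _ True E_sym p] z R by auto
    then show ?thesis using u' by blast
  qed (use zl z in blast)
  then obtain s where s: "s \<in> layer E v (Suc i)" "(u, s) \<in> E" "z = p \<or> z = s" by blast
  from ex_horizontal_cycle[OF u s(1,2) p] obtain C2
    where C2: "biconnected E C2" "C2 \<subseteq> {u, s} \<union> nball E v i" "u \<in> C2" "s \<in> C2" "p \<in> C2" .
  have "u \<noteq> z" using z E_irrefl by blast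
  then have bi: "biconnected E (C1 \<union> C2)"
    using biconnected_Un[OF C1(1) C2(1), of u z] C1 C2 z s(3) by blast
  have "nball E v i \<subseteq> nball E v R" "nball E v (Suc i) \<subseteq> nball E v R"
    using R by (auto intro!: nball_mono)
  moreover have "{w, w', u, s} \<subseteq> nball E v R"
    using layer_in[OF wl(1) R] layer_in[OF w'(1) R] layer_in[OF u] layer_in[OF s(1)] R by simp
  ultimately have U: "C1 \<union> C2 \<subseteq> nball E v R" using C1(2) C2(2) by blast
  have "u \<noteq> w'" "w \<noteq> p" "w \<noteq> s" "p \<noteq> s"
    by (rule layer_distinct[OF u w'(1)] layer_distinct[OF wl(1) p(1)] layer_distinct[OF wl(1) s(1)]
        layer_distinct[OF p(1) s(1)], simp)+
  with no_three_neighbours[OF bi U, of u w' u w p s] C1 C2 nw' s wl p E_sym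
  show False by blast
qed

section \<open>Counting children and grandchildren\<close>

lemma card_children:
  assumes u: "u \<in> layer E v (Suc i)" "Suc i \<le> R"
  shows "1 + card (E `` {u} \<inter> layer E v (Suc i)) + card (E `` {u} \<inter> layer E v (Suc (Suc i))) = \<Delta>"
proof -
  let ?N = "\<lambda>j. E `` {u} \<inter> layer E v j"
  obtain p where p: "p \<in> layer E v i" "(p, u) \<in> E" by (rule layer_parent[OF u(1)])
  have "?N i = {p}" using unique_parent[OF u _ _ p] p E_sym by blast
  then have "card (?N i) = 1" by simp
  moreover have "card (E `` {u}) = card (?N i) + card (?N (Suc i)) + card (?N (Suc (Suc i)))"
  proof -
    have "?N i \<inter> ?N (Suc i) = {}" "(?N i \<union> ?N (Suc i)) \<inter> ?N (Suc (Suc i)) = {}"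
      by (auto dest: layer_disjoint)
    then show ?thesis using neighbour_layers[OF u(1)] by (metis card_Un_disjoint finite_Un finite_nb)
  qed
  ultimately show ?thesis using regular[OF layer_in[OF u]] by simp
qed

text \<open>If all horizontal neighbours of \<open>u\<close> share its parent \<open>p\<close>, they
  and \<open>u\<close> are children of \<open>p\<close>, which has at most
  \<open>\<Delta> - 1\<close> children because it has a parent itself; hence the start at layer 2.
  Otherwise \<open>only_sibling\<close> leaves a single one, and \<open>3 \<le> \<Delta>\<close>
  suffices.\<close>

lemma card_siblings:
  assumes u: "u \<in> layer E v (Suc (Suc i))" "Suc (Suc i) \<le> R"
  shows "card (E `` {u} \<inter> layer E v (Suc (Suc i))) + 2 \<le> \<Delta>"
proof -
  let ?S = "E `` {u} \<inter> layer E v (Suc (Suc i))"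
  obtain p where p: "p \<in> layer E v (Suc i)" "(p, u) \<in> E" by (rule layer_parent[OF u(1)])
  show ?thesis
  proof (cases "?S \<subseteq> E `` {p}")
    case True
    have "insert u ?S \<subseteq> E `` {p} \<inter> layer E v (Suc (Suc i))" using True p u by blast
    then have "card (insert u ?S) \<le> card (E `` {p} \<inter> layer E v (Suc (Suc i)))"
      by (intro card_mono) auto
    moreover have "u \<notin> ?S" using E_irrefl by blast
    ultimately show ?thesis using card_children[OF p(1)] u(2) by simp
  next
    case False
    then obtain s where s: "s \<in> ?S" "(p, s) \<notin> E" by blast
    have "?S \<subseteq> {s}" using only_sibling[OF u p _ _ s(2)] s(1) by blast
    then have "card ?S \<le> card {s}" by (intro card_mono) auto
    then show ?thesis using Delta by simp
  qed
qed

text \<open>Two children have different children by \<open>unique_parent\<close>. A single child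
  \<open>w\<close> leaves \<open>\<Delta> - 2\<close> neighbours of \<open>u\<close> in its own
  layer, at least one; then \<open>w\<close> has none in its layer and hence
  \<open>\<Delta> - 1\<close> children.\<close>

lemma card_grandchildren:
  assumes u: "u \<in> layer E v (Suc (Suc i))" and R: "Suc (Suc (Suc (Suc i))) \<le> R"
  shows "2 \<le> card (E `` (E `` {u} \<inter> layer E v (Suc (Suc (Suc i)))) \<inter> layer E v (Suc (Suc (Suc (Suc i)))))" (is "2 \<le> card ?G")
proof -
  let ?C = "\<lambda>x j. E `` {x} \<inter> layer E v j"
  have finG: "finite ?G" by simp
  have child1: "1 \<le> card (?C x (Suc (Suc (Suc j))))" if "x \<in> layer E v (Suc (Suc j))" "Suc (Suc j) \<le> R" for x j
    using card_children[OF that] card_siblings[OF that] by linarith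
  have ne: "?C x (Suc (Suc (Suc j))) \<noteq> {}" if "x \<in> layer E v (Suc (Suc j))" "Suc (Suc j) \<le> R" for x j
    using child1[OF that] by fastforce
  show ?thesis
  proof (cases "2 \<le> card (?C u (Suc (Suc (Suc i))))")
    case True
    then obtain c1 c2 where c: "c1 \<in> ?C u (Suc (Suc (Suc i)))" "c2 \<in> ?C u (Suc (Suc (Suc i)))" "c1 \<noteq> c2"
      by (metis card_le_Suc0_iff_eq finite_nb not_less_eq_eq numeral_2_eq_2)
    obtain z1 where z1: "z1 \<in> ?C c1 (Suc (Suc (Suc (Suc i))))" using ne[of c1 "Suc i"] c(1) R by auto
    obtain z2 where z2: "z2 \<in> ?C c2 (Suc (Suc (Suc (Suc i))))" using ne[of c2 "Suc i"] c(2) R by auto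
    have "z1 \<noteq> z2"
      using unique_parent[of z1 "Suc (Suc (Suc i))" c1 c2] c z1 z2 R by auto
    then have "card {z1, z2} = 2" by simp
    moreover have "{z1, z2} \<subseteq> ?G" using c z1 z2 by blast
    ultimately show ?thesis using card_mono[OF finG] by metis
  next
    case False
    then have "card (?C u (Suc (Suc (Suc i)))) = 1" using child1[OF u] R by simp
    then obtain w where w: "?C u (Suc (Suc (Suc i))) = {w}" by (rule card_1_singletonE)
    have "1 + card (?C u (Suc (Suc i))) + 1 = \<Delta>"
      using card_children[OF u] R w by simp
    then have "?C u (Suc (Suc i)) \<noteq> {}" using Delta by force
    then obtain u' where "u' \<in> layer E v (Suc (Suc i))" "(u, u') \<in> E" by blast
    from only_child_no_sibling[OF u _ _ this, of w] w R
    have "?C w (Suc (Suc (Suc i))) = {}" by auto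
    moreover have "w \<in> layer E v (Suc (Suc (Suc i)))" using w by blast
    ultimately have "card (?C w (Suc (Suc (Suc (Suc i))))) = \<Delta> - 1"
      using card_children[of w "Suc (Suc i)"] R by auto
    moreover have "?C w (Suc (Suc (Suc (Suc i)))) \<subseteq> ?G" using w by blast
    then have "card (?C w (Suc (Suc (Suc (Suc i))))) \<le> card ?G" by (rule card_mono[OF finG])
    ultimately show ?thesis using Delta by linarith
  qed
qed

lemma layer_doubling:
  assumes "i + 4 \<le> R"
  shows "2 * card (layer E v (i + 2)) \<le> card (layer E v (i + 4))"
proof -
  define G where "G u = E `` (E `` {u} \<inter> layer E v (i + 3)) \<inter> layer E v (i + 4)" for u
  have num: "i + 2 = Suc (Suc i)" "i + 3 = Suc (Suc (Suc i))" "i + 4 = Suc (Suc (Suc (Suc i)))" by auto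
  have "2 \<le> card (G u)" if "u \<in> layer E v (i + 2)" for u
    using card_grandchildren[of u i] that assms unfolding G_def num by simp
  then have "2 * card (layer E v (i + 2)) \<le> (\<Sum>u\<in>layer E v (i + 2). card (G u))"
    using sum_mono[of "layer E v (i + 2)" "\<lambda>_. 2" "\<lambda>u. card (G u)"] by simp
  also have "\<dots> = card (\<Union>u\<in>layer E v (i + 2). G u)"
  proof (rule card_UN_disjoint[symmetric])
    show "\<forall>u\<in>layer E v (i + 2). \<forall>u'\<in>layer E v (i + 2). u \<noteq> u' \<longrightarrow> G u \<inter> G u' = {}"
    proof (intro ballI impI, rule ccontr)
      fix u u' assume u: "u \<in> layer E v (i + 2)" "u' \<in> layer E v (i + 2)" "u \<noteq> u'" "G u \<inter> G u' \<noteq> {}"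
      then obtain z c c' where z: "z \<in> layer E v (i + 4)" "(c, z) \<in> E" "(c', z) \<in> E"
        "c \<in> layer E v (i + 3)" "c' \<in> layer E v (i + 3)" "(u, c) \<in> E" "(u', c') \<in> E"
        unfolding G_def by blast
      have "c = c'" using unique_parent[of z "i + 3" c c'] z assms num by auto
      then have "u = u'" using unique_parent[of c "i + 2" u u'] z u(1,2) assms num by auto
      with u(3) show False ..
    qed
  qed (auto simp: G_def)
  also have "\<dots> \<le> card (layer E v (i + 4))"
    by (intro card_mono) (auto simp: G_def)
  finally show ?thesis .
qed

text \<open>Here the excluded complete graph enters: if the ball ended after one layer, its
  \<open>\<Delta> + 1\<close> vertices of degree \<open>\<Delta>\<close> would be pairwise
  adjacent.\<close>

lemma layer_2_nonempty: "2 \<le> R \<Longrightarrow> layer E v 2 \<noteq> {}"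
proof
  assume R: "2 \<le> R" and empty: "layer E v 2 = {}"
  let ?B = "nball E v 1"
  have B: "?B = insert v (E `` {v})" by (auto simp: nball.simps)
  have "card (E `` {v}) = \<Delta>" using regular[of v] by simp
  then have cB: "card ?B = \<Delta> + 1" using B E_irrefl finite_neighbours by simp
  have "E `` {x} = ?B - {x}" if x: "x \<in> ?B" for x
  proof (rule card_subset_eq)
    show "E `` {x} \<subseteq> ?B - {x}"
    proof
      fix y assume "y \<in> E `` {x}"
      then have y: "(x, y) \<in> E" by simp
      have "y \<in> nball E v (Suc 1)" using nball_step[OF x y] .
      then obtain j where j: "j \<le> Suc 1" "y \<in> layer E v j" by (rule nball_layer)
      then have "j \<noteq> 2" using empty by auto
      then have "j \<le> 1" using j(1) by simp
      then have "y \<in> ?B" using layer_in_nball[OF j(2)] nball_mono[of j 1 E v] by blast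
      then show "y \<in> ?B - {x}" using y E_irrefl by blast
    qed
    have "x \<in> nball E v R" using x R nball_mono[of 1 R E v] by auto
    then show "card (E `` {x}) = card (?B - {x})" using regular cB x by (simp del: One_nat_def)
  qed (simp del: One_nat_def)
  then have "clique E ?B" unfolding clique_def by blast
  with no_clique[OF cB] show False by blast
qed

lemma exponential_layer: "2 * k + 2 \<le> R \<Longrightarrow> 2 ^ k \<le> card (layer E v (2 * k + 2))"
proof (induction k)
  case 0
  then have "card (layer E v 2) \<noteq> 0" using layer_2_nonempty by simp
  then have "1 \<le> card (layer E v 2)" by linarith
  moreover have "2 * 0 + 2 = (2 :: nat)" by simp
  ultimately show ?case by (metis power_0)
next
  case (Suc k)
  then have "2 ^ k \<le> card (layer E v (2 * k + 2))" by simp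
  moreover have "2 * card (layer E v (2 * k + 2)) \<le> card (layer E v (2 * k + 4))"
    using layer_doubling[of "2 * k"] Suc.prems by simp
  moreover have "2 * Suc k + 2 = 2 * k + 4" by simp
  ultimately show ?case by (metis mult_le_mono2 order_trans power_Suc)
qed

end

subsection \<open>Functions of local views\<close>

definition same_view :: "('a \<times> 'a) set \<Rightarrow> ('a \<times> 'a) set \<Rightarrow> nat \<Rightarrow> 'a \<Rightarrow> bool" where
  "same_view E E' t x \<longleftrightarrow> nball E x t = nball E' x t \<and>
     E \<inter> nball E x t \<times> nball E x t = E' \<inter> nball E' x t \<times> nball E' x t"

definition local_fun :: "nat \<Rightarrow> (('a \<times> 'a) set \<Rightarrow> 'a \<Rightarrow> 'b) \<Rightarrow> bool" where
  "local_fun t \<Phi> \<longleftrightarrow> (\<forall>E E' x. same_view E E' t x \<longrightarrow> \<Phi> E x = \<Phi> E' x)"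

lemma nball_restrict:
  assumes "nball E y t \<subseteq> B" "j \<le> t"
  shows "nball (E \<inter> B \<times> B) y j = nball E y j"
  using assms(2)
proof (induction j)
  case (Suc j)
  have "nball E y (Suc j) \<subseteq> B" "nball E y j \<subseteq> B"
    using assms(1) nball_mono[of "Suc j" t E y] nball_mono[of j t E y] Suc.prems by auto
  with Suc show ?case by (auto simp: nball.simps)
qed simp

lemma same_view_restrict:
  assumes "same_view E E' (t + s) x" "y \<in> nball E x s"
  shows "same_view E E' t y" and "y \<in> nball E' x s"
proof -
  let ?B = "nball E x (t + s)"
  have B: "nball E' x (t + s) = ?B" "E \<inter> ?B \<times> ?B = E' \<inter> ?B \<times> ?B"
    using assms(1) unfolding same_view_def by auto
  have eq: "nball E x j = nball E' x j" if "j \<le> t + s" for j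
    using nball_restrict[of E x "t + s" ?B j] nball_restrict[of E' x "t + s" ?B j] that B by simp
  show y': "y \<in> nball E' x s" using eq[of s] assms(2) by simp
  have sub: "nball E y t \<subseteq> ?B" "nball E' y t \<subseteq> ?B"
    using nball_trans[OF assms(2), of _ t] nball_trans[OF y', of _ t] B(1) by (auto simp: add.commute)
  have "nball E y t = nball E' y t"
    using nball_restrict[OF sub(1), of t] nball_restrict[OF sub(2), of t] B(2) by simp
  with sub B(2) show "same_view E E' t y" unfolding same_view_def by blast
qed

lemma same_view_mono: "same_view E E' t x \<Longrightarrow> s \<le> t \<Longrightarrow> same_view E E' s x"
  using same_view_restrict(1)[of E E' s "t - s" x x] by simp

lemma same_view_nball: "same_view E E' t x \<Longrightarrow> s \<le> t \<Longrightarrow> nball E x s = nball E' x s"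
  using same_view_mono[of E E' t x s] unfolding same_view_def by blast

text \<open>The inequality \<open>s < t\<close> is strict because a vertex on the boundary of the
  ball may have neighbours outside it.\<close>

lemma same_view_neighbours:
  assumes "same_view E E' t x" "s < t" "y \<in> nball E x s"
  shows "E `` {y} = E' `` {y}"
proof -
  have "same_view E E' 1 y"
    using same_view_restrict(1)[of E E' 1 s x y] same_view_mono[OF assms(1), of "1 + s"] assms by simp
  then have B: "nball E y 1 = nball E' y 1"
    "E \<inter> nball E y 1 \<times> nball E y 1 = E' \<inter> nball E' y 1 \<times> nball E' y 1"
    unfolding same_view_def by auto
  have "E `` {y} \<subseteq> nball E y 1" "E' `` {y} \<subseteq> nball E' y 1" by (auto simp: nball.simps)
  with B nball_center[of y E 1] show ?thesis by blast
qed

lemma local_fun_mono: "local_fun s \<Phi> \<Longrightarrow> s \<le> t \<Longrightarrow> local_fun t \<Phi>"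
  unfolding local_fun_def by (metis same_view_mono)

text \<open>One further phase that reads earlier results within distance \<open>s\<close>: a view of
  radius \<open>t + s\<close> contains the views of radius \<open>t\<close> of all vertices within
  distance \<open>s\<close>, so the radii of successive phases add up.\<close>

lemma local_fun_step:
  fixes \<Phi> :: "('a \<times> 'a) set \<Rightarrow> 'a \<Rightarrow> 'b" and \<Psi> :: "('a \<times> 'a) set \<Rightarrow> 'a \<Rightarrow> 'c"
  assumes "local_fun t \<Phi>"
    and "\<And>E E' x. same_view E E' s x \<Longrightarrow> (\<And>y. y \<in> nball E x s \<Longrightarrow> \<Phi> E y = \<Phi> E' y) \<Longrightarrow> \<Psi> E x = \<Psi> E' x"
  shows "local_fun (t + s) \<Psi>"
  unfolding local_fun_def
proof (intro allI impI)
  fix E E' :: "('a \<times> 'a) set" and x assume *: "same_view E E' (t + s) x"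
  show "\<Psi> E x = \<Psi> E' x"
  proof (rule assms(2))
    show "same_view E E' s x" using same_view_mono[OF *] by simp
    show "\<Phi> E y = \<Phi> E' y" if "y \<in> nball E x s" for y
      using same_view_restrict(1)[OF * that] assms(1) unfolding local_fun_def by blast
  qed
qed

lemma local_fun_Pair:
  "local_fun t \<Phi> \<Longrightarrow> local_fun t \<Psi> \<Longrightarrow> local_fun t (\<lambda>E x. (\<Phi> E x, \<Psi> E x))"
  unfolding local_fun_def by blast

subsection \<open>Colour reduction\<close>

text \<open>A set of at most \<open>d\<close> elements can be read off a list of length exactly
  \<open>d\<close> over \<open>A\<close> with \<open>None\<close> as padding, and there are
  \<open>(card A + 1) ^ d\<close> such lists.\<close>

lemma ex_set_encoding:
  assumes "finite A"
  shows "\<exists>e. inj_on e {S. S \<subseteq> A \<and> card S \<le> d} \<and> (\<forall>S. S \<subseteq> A \<and> card S \<le> d \<longrightarrow> e S < (card A + 1) ^ d)"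
proof -
  let ?\<S> = "{S. S \<subseteq> A \<and> card S \<le> d}"
  let ?X = "insert None (Some ` A)"
  let ?Y = "{l. set l \<subseteq> ?X \<and> length l = d}"
  have fin: "finite ?X" using assms by simp
  have finY: "finite ?Y" using finite_lists_length_eq[OF fin] .
  have cX: "card ?X = card A + 1" using assms by (subst card_insert_disjoint) (auto simp: card_image)
  have sub: "?\<S> \<subseteq> (\<lambda>l. {s. Some s \<in> set l}) ` ?Y"
  proof
    fix S assume S: "S \<in> ?\<S>"
    then have "finite S" using assms finite_subset by blast
    then obtain xs where xs: "set xs = S" "distinct xs" using finite_distinct_list by blast
    have "length xs \<le> d" using xs S distinct_card[of xs] by simp
    then have "map Some xs @ replicate (d - length xs) None \<in> ?Y"
      using xs S by auto
    moreover have "S = {s. Some s \<in> set (map Some xs @ replicate (d - length xs) None)}"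
      using xs by auto
    ultimately show "S \<in> (\<lambda>l. {s. Some s \<in> set l}) ` ?Y" by blast
  qed
  have fS: "finite ?\<S>" by (rule finite_subset[OF sub finite_imageI[OF finY]])
  have "card ?\<S> \<le> card ?Y"
    using card_mono[OF finite_imageI[OF finY] sub] card_image_le[OF finY] by (rule order_trans)
  then have card: "card ?\<S> \<le> (card A + 1) ^ d" using card_lists_length_eq[OF fin] cX by simp
  obtain e where e: "bij_betw e ?\<S> {0..<card ?\<S>}" using ex_bij_betw_finite_nat[OF fS] by blast
  have "e S < (card A + 1) ^ d" if "S \<subseteq> A" "card S \<le> d" for S
  proof -
    have "e S \<in> {0..<card ?\<S>}" using e that unfolding bij_betw_def by blast
    with card show ?thesis by simp
  qed
  with e show ?thesis unfolding bij_betw_def by blast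
qed

text \<open>One choice for each \<open>d\<close> and \<open>b\<close>, so all vertices encode their
  sets by the same injection.\<close>

definition set_code :: "nat \<Rightarrow> nat \<Rightarrow> (nat \<times> bool) set \<Rightarrow> nat" where
  "set_code d b = (SOME e. inj_on e {S. S \<subseteq> {..<b} \<times> UNIV \<and> card S \<le> d} \<and>
     (\<forall>S. S \<subseteq> {..<b} \<times> UNIV \<and> card S \<le> d \<longrightarrow> e S < (2 * b + 1) ^ d))"

lemma set_code:
  shows "inj_on (set_code d b) {S. S \<subseteq> {..<b} \<times> UNIV \<and> card S \<le> d}"
    and "S \<subseteq> {..<b} \<times> UNIV \<Longrightarrow> card S \<le> d \<Longrightarrow> set_code d b S < (2 * b + 1) ^ d"
proof -
  have "card ({..<b} \<times> (UNIV :: bool set)) = 2 * b" by (simp add: card_cartesian_product)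
  with ex_set_encoding[of "{..<b} \<times> (UNIV :: bool set)" d]
  have "\<exists>e. inj_on e {S. S \<subseteq> {..<b} \<times> (UNIV :: bool set) \<and> card S \<le> d} \<and>
     (\<forall>S. S \<subseteq> {..<b} \<times> UNIV \<and> card S \<le> d \<longrightarrow> e S < (2 * b + 1) ^ d)" by simp
  from someI_ex[OF this] show "inj_on (set_code d b) {S. S \<subseteq> {..<b} \<times> UNIV \<and> card S \<le> d}"
    "S \<subseteq> {..<b} \<times> UNIV \<Longrightarrow> card S \<le> d \<Longrightarrow> set_code d b S < (2 * b + 1) ^ d"
    unfolding set_code_def by blast+
qed

definition first_diff :: "nat \<Rightarrow> nat \<Rightarrow> nat" where
  "first_diff a b = (LEAST i. bit a i \<noteq> bit b i)"

text \<open>Cole--Vishkin without an orientation: the new colour is the \<^emph>\<open>set\<close> of (first differing bit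
  position, own bit there) over all neighbours, so that no matching of the neighbours of adjacent
  vertices is needed.\<close>

definition diff_set :: "('a \<Rightarrow> nat) \<Rightarrow> 'a \<Rightarrow> 'a set \<Rightarrow> (nat \<times> bool) set" where
  "diff_set a x N = (\<lambda>y. (first_diff (a x) (a y), bit (a x) (first_diff (a x) (a y)))) ` N"

lemma first_diff:
  assumes "a \<noteq> b" shows "bit a (first_diff a b) \<noteq> bit b (first_diff a b)"
proof -
  have "\<exists>i. bit a i \<noteq> bit b i" using assms bit_eqI[of a b] by blast
  then show ?thesis unfolding first_diff_def by (rule LeastI_ex)
qed

lemma first_diff_less:
  assumes "a \<noteq> b" "a < 2 ^ m" "b < 2 ^ m" shows "first_diff a b < m"
proof (rule ccontr)
  assume "\<not> ?thesis"
  then have m: "m \<le> first_diff a b" by simp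
  have "\<not> bit c i" if "c < 2 ^ m" "m \<le> i" for c i :: nat
  proof -
    have "c < 2 ^ i" using that power_increasing[of m i "2 :: nat"] by linarith
    then show ?thesis by (simp add: bit_iff_odd)
  qed
  with first_diff[OF assms(1)] assms(2,3) m show False by blast
qed

text \<open>The pair that \<open>y\<close> contributes to the set of \<open>x\<close> carries the
  bit of \<open>x\<close> at a position where \<open>x\<close> and \<open>y\<close> differ. A pair
  in the set of \<open>y\<close> at this position carries the bit of \<open>y\<close>, whichever
  neighbour produced it.\<close>

lemma diff_set_neq:
  assumes "a x \<noteq> a y" "y \<in> N" "x \<in> M" "\<And>z. z \<in> M \<Longrightarrow> a y \<noteq> a z"
  shows "diff_set a x N \<noteq> diff_set a y M"
proof
  assume eq: "diff_set a x N = diff_set a y M"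
  let ?i = "first_diff (a x) (a y)"
  have "(?i, bit (a x) ?i) \<in> diff_set a y M"
    unfolding eq[symmetric] using assms(2) by (auto simp: diff_set_def)
  then have "bit (a x) ?i = bit (a y) ?i" by (auto simp: diff_set_def)
  with first_diff[OF assms(1)] show False by simp
qed

primrec bits :: "nat \<Rightarrow> nat \<Rightarrow> nat \<Rightarrow> nat" where
  "bits d b 0 = b"
| "bits d b (Suc i) = d * nat \<lceil>log 2 (real (2 * bits d b i + 1))\<rceil>"

text \<open>Vertices within distance \<open>r\<close> count as neighbours: the reduction runs on a
  power of the graph, and one round costs radius \<open>r\<close>.\<close>

primrec reduced :: "nat \<Rightarrow> nat \<Rightarrow> nat \<Rightarrow> ('a \<Rightarrow> nat) \<Rightarrow> nat \<Rightarrow> ('a \<times> 'a) set \<Rightarrow> 'a \<Rightarrow> nat" where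
  "reduced r d b a 0 E x = a x"
| "reduced r d b a (Suc i) E x =
     set_code d (bits d b i) (diff_set (reduced r d b a i E) x (nball E x r - {x}))"

lemma local_reduced: "local_fun (i * r) (reduced r d b a i)"
proof (induction i)
  case 0
  then show ?case by (simp add: local_fun_def)
next
  case (Suc i)
  have "local_fun (i * r + r) (reduced r d b a (Suc i))"
  proof (rule local_fun_step[OF Suc.IH])
    fix E E' :: "('a \<times> 'a) set" and x
    assume E: "same_view E E' r x" "\<And>y. y \<in> nball E x r \<Longrightarrow> reduced r d b a i E y = reduced r d b a i E' y"
    have "nball E x r = nball E' x r" using E(1) by (simp add: same_view_def)
    moreover have "diff_set (reduced r d b a i E) x (nball E x r - {x}) =
        diff_set (reduced r d b a i E') x (nball E x r - {x})"
      unfolding diff_set_def using E(2) by (intro image_cong) auto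
    ultimately show "reduced r d b a (Suc i) E x = reduced r d b a (Suc i) E' x" by simp
  qed
  then show ?case by (simp add: add.commute del: reduced.simps)
qed

lemma bits_ge: "(2 * bits d b i + 1) ^ d \<le> 2 ^ bits d b (Suc i)"
proof -
  let ?m = "2 * bits d b i + 1" and ?l = "nat \<lceil>log 2 (real (2 * bits d b i + 1))\<rceil>"
  have "log 2 (real ?m) \<le> real ?l" by linarith
  then have "real ?m \<le> 2 powr real ?l" by (subst (asm) log_le_iff) auto
  also have "\<dots> = real (2 ^ ?l)" by (subst powr_realpow) simp_all
  finally have "?m \<le> 2 ^ ?l" by (simp only: of_nat_le_iff)
  then have "?m ^ d \<le> (2 ^ ?l) ^ d" by (rule power_mono) simp
  then show ?thesis by (simp add: power_mult[symmetric] mult.commute)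
qed

context simple_graph
begin

lemma reduced_proper:
  assumes small: "\<And>x. card (nball E x r) \<le> d"
    and a: "\<And>x. a x < 2 ^ b" "\<And>x y. y \<in> nball E x r \<Longrightarrow> x \<noteq> y \<Longrightarrow> a x \<noteq> a y"
  shows "(\<forall>x. reduced r d b a i E x < 2 ^ bits d b i) \<and>
    (\<forall>x. \<forall>y\<in>nball E x r. x \<noteq> y \<longrightarrow> reduced r d b a i E x \<noteq> reduced r d b a i E y)"
proof (induction i)
  case 0
  then show ?case using a by simp
next
  case (Suc i)
  let ?a = "reduced r d b a i E" and ?N = "\<lambda>x. nball E x r - {x}"
  let ?D = "\<lambda>x. diff_set ?a x (?N x)"
  have D: "?D x \<subseteq> {..<bits d b i} \<times> UNIV" "card (?D x) \<le> d" for x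
  proof -
    have "first_diff (?a x) (?a y) < bits d b i" if "y \<in> ?N x" for y
      using Suc.IH that by (intro first_diff_less) auto
    then show "?D x \<subseteq> {..<bits d b i} \<times> UNIV" by (auto simp: diff_set_def)
    have "card (?D x) \<le> card (?N x)" unfolding diff_set_def by (rule card_image_le) simp
    also have "\<dots> \<le> card (nball E x r)" by (rule card_mono) auto
    finally show "card (?D x) \<le> d" using small[of x] by linarith
  qed
  have "reduced r d b a (Suc i) E x < 2 ^ bits d b (Suc i)" for x
  proof -
    have "set_code d (bits d b i) (?D x) < (2 * bits d b i + 1) ^ d" by (rule set_code(2)) (rule D)+
    with bits_ge[of d b i] show ?thesis unfolding reduced.simps by linarith
  qed
  moreover have "reduced r d b a (Suc i) E x \<noteq> reduced r d b a (Suc i) E y"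
    if xy: "y \<in> nball E x r" "x \<noteq> y" for x y
  proof -
    have "x \<in> nball E y r" using nball_sym xy(1) .
    have "?D x \<noteq> ?D y"
      by (rule diff_set_neq) (use Suc.IH xy \<open>x \<in> nball E y r\<close> in auto)
    then show ?thesis
      using inj_onD[OF set_code(1)[of d "bits d b i"], of "?D x" "?D y"] D by auto
  qed
  ultimately show ?case by blast
qed

end

subsection \<open>The colouring algorithm\<close>

text \<open>Against any partial \<open>\<Delta>\<close>-colouring of the vertices outside \<open>D\<close>, a vertex \<open>x\<close> of \<open>D\<close> keeps at least
  \<open>\<Delta> - (deg x - deg\<^sub>D x)\<close> colours; hence every such colouring extends to a core. The inequality is
  arranged to avoid truncated subtraction.\<close>

definition core :: "nat \<Rightarrow> ('a \<times> 'a) set \<Rightarrow> 'a set \<Rightarrow> bool" where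
  "core \<Delta> E D \<longleftrightarrow> D \<noteq> {} \<and> finite D \<and>
     (\<forall>L. (\<forall>x\<in>D. finite (L x) \<and> degree_in E D x + \<Delta> \<le> card (L x) + card (E `` {x})) \<longrightarrow>
       (\<exists>\<phi>. list_coloring E D L \<phi>))"

text \<open>The choice depends only on the edges near \<open>v\<close>
  (\<open>local_core_at\<close>), so all vertices of the core agree on it.\<close>

definition core_at :: "nat \<Rightarrow> nat \<Rightarrow> ('a \<times> 'a) set \<Rightarrow> 'a \<Rightarrow> 'a set" where
  "core_at \<Delta> R E v =
     (if \<exists>D \<subseteq> nball E v R. core \<Delta> E D then SOME D. D \<subseteq> nball E v R \<and> core \<Delta> E D else {})"

text \<open>A greedy maximal independent set of the \<open>r\<close>-th power, one colour class at a
  time; members of a class may join together when \<open>\<kappa>\<close> is proper on that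
  power.\<close>

primrec ruling :: "nat \<Rightarrow> ('a \<times> 'a) set \<Rightarrow> ('a \<Rightarrow> nat) \<Rightarrow> nat \<Rightarrow> 'a set" where
  "ruling r E \<kappa> 0 = {}"
| "ruling r E \<kappa> (Suc j) =
     ruling r E \<kappa> j \<union> {x. \<kappa> x = j \<and> nball E x r \<inter> ruling r E \<kappa> j = {}}"

definition centres :: "nat \<Rightarrow> nat \<Rightarrow> ('a \<times> 'a) set \<Rightarrow> 'a set \<Rightarrow> 'a \<Rightarrow> 'a set" where
  "centres \<Delta> R E I x = {v \<in> nball E x R. v \<in> I \<and> x \<in> core_at \<Delta> R E v}"

text \<open>The distance to the nearest vertex with \<open>Q\<close>, cut off at
  \<open>\<rho>\<close> so that a bounded view determines it.\<close>

definition depth :: "nat \<Rightarrow> ('a \<times> 'a) set \<Rightarrow> ('a \<Rightarrow> bool) \<Rightarrow> 'a \<Rightarrow> nat" where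
  "depth \<rho> E Q x = (LEAST j. j = \<rho> \<or> (\<exists>y\<in>nball E x j. Q y))"

primrec greedy :: "('a \<times> 'a) set \<Rightarrow> ('a \<Rightarrow> nat) \<Rightarrow> ('a \<Rightarrow> bool) \<Rightarrow> nat \<Rightarrow> 'a \<Rightarrow> nat option" where
  "greedy E p Q 0 x = None"
| "greedy E p Q (Suc j) x =
     (if p x = j \<and> \<not> Q x then Some (LEAST c. \<forall>y\<in>E `` {x}. greedy E p Q j y \<noteq> Some c)
      else greedy E p Q j x)"

definition free_colours :: "nat \<Rightarrow> ('a \<times> 'a) set \<Rightarrow> ('a \<Rightarrow> nat option) \<Rightarrow> 'a \<Rightarrow> nat set" where
  "free_colours \<Delta> E g y = {..<\<Delta>} - {c. \<exists>z\<in>E `` {y}. g z = Some c}"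

definition finish :: "nat \<Rightarrow> nat \<Rightarrow> ('a \<times> 'a) set \<Rightarrow> 'a set \<Rightarrow> ('a \<Rightarrow> nat option) \<Rightarrow> 'a \<Rightarrow> nat" where
  "finish \<Delta> R E I g x =
     (if centres \<Delta> R E I x = {} then the (g x)
      else (SOME \<phi>. list_coloring E (core_at \<Delta> R E (SOME v. v \<in> centres \<Delta> R E I x))
              (free_colours \<Delta> E g) \<phi>) x)"

text \<open>Centres more than \<open>2 * R + 1\<close> apart have disjoint, nonadjacent cores. Every
  vertex has a centre within \<open>2 * R + 1\<close>, hence a core vertex within
  \<open>3 * R + 1\<close>. Priorities rank by distance first, the farthest lowest, and
  \<open>\<kappa> < K\<close> breaks ties, so they stay below
  \<open>(3 * R + 2) * K\<close>.\<close>

definition brooks :: "nat \<Rightarrow> nat \<Rightarrow> nat \<Rightarrow> ('a \<times> 'a) set \<Rightarrow> ('a \<Rightarrow> nat) \<Rightarrow> 'a \<Rightarrow> nat" where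
  "brooks \<Delta> R K E \<kappa> =
     (let I = ruling (2 * R + 1) E \<kappa> K;
          Q = (\<lambda>x. centres \<Delta> R E I x \<noteq> {});
          p = (\<lambda>x. (3 * R + 1 - depth (3 * R + 1) E Q x) * K + \<kappa> x)
      in finish \<Delta> R E I (greedy E p Q ((3 * R + 2) * K)))"

subsection \<open>Locality\<close>

lemma core_at_subset: "core_at \<Delta> R E v \<subseteq> nball E v R"
  unfolding core_at_def using someI_ex[of "\<lambda>D. D \<subseteq> nball E v R \<and> core \<Delta> E D"] by auto

lemma list_coloring_cong:
  assumes "\<And>x. x \<in> D \<Longrightarrow> E `` {x} = E' `` {x}" "\<And>x. x \<in> D \<Longrightarrow> L x = L' x"
  shows "list_coloring E D L \<phi> = list_coloring E' D L' \<phi>"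
proof -
  have "(x, y) \<in> E \<longleftrightarrow> (x, y) \<in> E'" if "x \<in> D" for x y using assms(1)[OF that] by blast
  with assms(2) show ?thesis unfolding list_coloring_def by (metis (no_types, lifting))
qed

lemma core_cong:
  assumes "\<And>x. x \<in> D \<Longrightarrow> E `` {x} = E' `` {x}"
  shows "core \<Delta> E D = core \<Delta> E' D"
proof -
  have "list_coloring E D L = list_coloring E' D L" for L
    by (rule ext, rule list_coloring_cong) (use assms in auto)
  moreover have "degree_in E D x = degree_in E' D x" if "x \<in> D" for x
    using assms[OF that] by (simp add: degree_in_def)
  ultimately show ?thesis using assms unfolding core_def by simp
qed

text \<open>Being a core involves the full degrees of vertices at distance \<open>R\<close>; these
  are visible from radius \<open>R + 1\<close>.\<close>

lemma local_core_at: "local_fun (R + 1) (core_at \<Delta> R)"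
  unfolding local_fun_def
proof (intro allI impI)
  fix E E' :: "('a \<times> 'a) set" and x assume same: "same_view E E' (R + 1) x"
  have ball: "nball E x R = nball E' x R" using same_view_nball[OF same] by simp
  have "core \<Delta> E D = core \<Delta> E' D" if "D \<subseteq> nball E x R" for D
    by (rule core_cong, rule same_view_neighbours[OF same, of R]) (use that in auto)
  then have eq: "(\<lambda>D. D \<subseteq> nball E x R \<and> core \<Delta> E D) = (\<lambda>D. D \<subseteq> nball E' x R \<and> core \<Delta> E' D)"
    using ball by auto
  show "core_at \<Delta> R E x = core_at \<Delta> R E' x" unfolding core_at_def eq ..
qed

lemma local_ruling:
  assumes "local_fun t \<kappa>"
  shows "local_fun (t + j * r) (\<lambda>E x. x \<in> ruling r E (\<kappa> E) j)"
proof (induction j)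
  case 0
  then show ?case by (simp add: local_fun_def)
next
  case (Suc j)
  have \<kappa>: "local_fun (t + j * r) \<kappa>" using local_fun_mono[OF assms] by simp
  have "local_fun (t + j * r + r) (\<lambda>E x. x \<in> ruling r E (\<kappa> E) (Suc j))"
  proof (rule local_fun_step[OF local_fun_Pair[OF Suc.IH \<kappa>]])
    fix E E' :: "('a \<times> 'a) set" and x
    assume same: "same_view E E' r x"
      and "\<And>y. y \<in> nball E x r \<Longrightarrow> (y \<in> ruling r E (\<kappa> E) j, \<kappa> E y) = (y \<in> ruling r E' (\<kappa> E') j, \<kappa> E' y)"
    then have eq: "(y \<in> ruling r E (\<kappa> E) j) = (y \<in> ruling r E' (\<kappa> E') j)" "\<kappa> E y = \<kappa> E' y"
      if "y \<in> nball E x r" for y using that by blast+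
    have "nball E x r = nball E' x r" using same by (simp add: same_view_def)
    moreover have "nball E x r \<inter> ruling r E (\<kappa> E) j = nball E x r \<inter> ruling r E' (\<kappa> E') j"
      using eq(1) by blast
    ultimately show "(x \<in> ruling r E (\<kappa> E) (Suc j)) = (x \<in> ruling r E' (\<kappa> E') (Suc j))"
      using eq[of x] by auto
  qed
  then show ?case by (simp add: algebra_simps)
qed

lemma local_centres:
  assumes "local_fun t (\<lambda>E x. x \<in> I E)" "R + 1 \<le> t"
  shows "local_fun (t + R) (\<lambda>E. centres \<Delta> R E (I E))"
proof (rule local_fun_step[OF local_fun_Pair[OF assms(1) local_fun_mono[OF local_core_at assms(2)]]])
  fix E E' :: "('a \<times> 'a) set" and x
  assume same: "same_view E E' R x" and
    "\<And>y. y \<in> nball E x R \<Longrightarrow> (y \<in> I E, core_at \<Delta> R E y) = (y \<in> I E', core_at \<Delta> R E' y)"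
  moreover have "nball E x R = nball E' x R" using same by (simp add: same_view_def)
  ultimately show "centres \<Delta> R E (I E) x = centres \<Delta> R E' (I E') x" unfolding centres_def by auto
qed

lemma local_depth:
  assumes "local_fun t Q"
  shows "local_fun (t + \<rho>) (\<lambda>E. depth \<rho> E (Q E))"
proof (rule local_fun_step[OF assms])
  fix E E' :: "('a \<times> 'a) set" and x
  assume same: "same_view E E' \<rho> x" and eq: "\<And>y. y \<in> nball E x \<rho> \<Longrightarrow> Q E y = Q E' y"
  have ex: "(\<exists>y\<in>nball E x j. Q E y) = (\<exists>y\<in>nball E' x j. Q E' y)" if "j \<le> \<rho>" for j
    using same_view_nball[OF same that] eq nball_mono[OF that, of E x] by auto
  \<comment> \<open>Both least indices are at most the cap, so agreement up to \<open>\<rho>\<close>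
    is enough.\<close>
  have least: "(LEAST j. j = \<rho> \<or> P j) = (LEAST j. j = \<rho> \<or> P' j)"
    if "\<And>j. j \<le> \<rho> \<Longrightarrow> P j = P' j" for P P'
  proof (rule Least_equality)
    have "(LEAST j. j = \<rho> \<or> P' j) \<le> \<rho>" by (rule Least_le) simp
    moreover have "(LEAST j. j = \<rho> \<or> P' j) = \<rho> \<or> P' (LEAST j. j = \<rho> \<or> P' j)"
      by (rule LeastI[of _ \<rho>]) simp
    ultimately show "(LEAST j. j = \<rho> \<or> P' j) = \<rho> \<or> P (LEAST j. j = \<rho> \<or> P' j)" using that by blast
    fix j assume j: "j = \<rho> \<or> P j"
    show "(LEAST j. j = \<rho> \<or> P' j) \<le> j"
    proof (cases "j \<le> \<rho>")
      case True
      then show ?thesis using j that[of j] by (intro Least_le) blast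
    next
      case False
      then show ?thesis using \<open>(LEAST j. j = \<rho> \<or> P' j) \<le> \<rho>\<close> by linarith
    qed
  qed
  show "depth \<rho> E (Q E) x = depth \<rho> E' (Q E') x" unfolding depth_def by (rule least) (rule ex)
qed

lemma local_greedy:
  assumes "local_fun t p" "local_fun t Q"
  shows "local_fun (t + j) (\<lambda>E. greedy E (p E) (Q E) j)"
proof (induction j)
  case 0
  then show ?case by (simp add: local_fun_def)
next
  case (Suc j)
  have pQ: "local_fun (t + j) (\<lambda>E x. (p E x, Q E x))" using local_fun_mono[OF local_fun_Pair[OF assms]] by simp
  have "local_fun (t + j + 1) (\<lambda>E. greedy E (p E) (Q E) (Suc j))"
  proof (rule local_fun_step[OF local_fun_Pair[OF Suc.IH pQ]])
    fix E E' :: "('a \<times> 'a) set" and x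
    assume same: "same_view E E' 1 x"
      and "\<And>y. y \<in> nball E x 1 \<Longrightarrow> (greedy E (p E) (Q E) j y, p E y, Q E y) =
        (greedy E' (p E') (Q E') j y, p E' y, Q E' y)"
    then have eq: "greedy E (p E) (Q E) j y = greedy E' (p E') (Q E') j y" "p E y = p E' y" "Q E y = Q E' y"
      if "y \<in> nball E x 1" for y using that by blast+
    have nb: "E `` {x} = E' `` {x}" using same_view_neighbours[OF same, of 0 x] by simp
    have "(\<forall>y\<in>E `` {x}. greedy E (p E) (Q E) j y \<noteq> Some c) =
        (\<forall>y\<in>E' `` {x}. greedy E' (p E') (Q E') j y \<noteq> Some c)" for c
      unfolding nb[symmetric] using eq(1) by (intro ball_cong) (auto simp: nball.simps)
    with eq[of x] show "greedy E (p E) (Q E) (Suc j) x = greedy E' (p E') (Q E') (Suc j) x" by simp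
  qed
  then show ?case by (simp del: greedy.simps)
qed

lemma local_finish:
  assumes "local_fun t (\<lambda>E. centres \<Delta> R E (I E))" "local_fun t g" "R + 1 \<le> t"
  shows "local_fun (t + (2 * R + 2)) (\<lambda>E. finish \<Delta> R E (I E) (g E))"
proof (rule local_fun_step[OF local_fun_Pair[OF assms(1) local_fun_Pair[OF assms(2)
      local_fun_mono[OF local_core_at assms(3)]]]])
  fix E E' :: "('a \<times> 'a) set" and x
  assume same: "same_view E E' (2 * R + 2) x"
    and "\<And>y. y \<in> nball E x (2 * R + 2) \<Longrightarrow> (centres \<Delta> R E (I E) y, g E y, core_at \<Delta> R E y) =
      (centres \<Delta> R E' (I E') y, g E' y, core_at \<Delta> R E' y)"
  then have eq: "centres \<Delta> R E (I E) y = centres \<Delta> R E' (I E') y" "g E y = g E' y"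
      "core_at \<Delta> R E y = core_at \<Delta> R E' y" if "y \<in> nball E x (2 * R + 2)" for y using that by blast+
  show "finish \<Delta> R E (I E) (g E) x = finish \<Delta> R E' (I E') (g E') x"
  proof (cases "centres \<Delta> R E (I E) x = {}")
    case True
    then show ?thesis using eq[of x] by (simp add: finish_def)
  next
    case False
    define v where "v = (SOME v. v \<in> centres \<Delta> R E (I E) x)"
    have v': "v = (SOME v. v \<in> centres \<Delta> R E' (I E') x)" using eq(1)[of x] by (simp add: v_def)
    have "v \<in> centres \<Delta> R E (I E) x" unfolding v_def using False some_in_eq by blast
    then have v: "v \<in> nball E x R" by (simp add: centres_def)
    let ?D = "core_at \<Delta> R E v"
    have "v \<in> nball E x (2 * R + 2)" using v nball_mono[of R "2 * R + 2" E x] by auto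
    then have D: "core_at \<Delta> R E' v = ?D" using eq(3) by simp
    \<comment> \<open>The core of \<open>v\<close> reaches at most \<open>2 * R\<close> from
      \<open>x\<close>, and the free colours of its vertices read \<open>g\<close> one step
      further.\<close>
    have Dx: "?D \<subseteq> nball E x (2 * R)"
      using nball_trans[OF v, of _ R] core_at_subset[of \<Delta> R E v] by (auto simp: mult_2)
    have nb: "E `` {y} = E' `` {y}" if "y \<in> ?D" for y
      using same_view_neighbours[OF same, of "2 * R" y] Dx that by auto
    have free: "free_colours \<Delta> E (g E) y = free_colours \<Delta> E' (g E') y" if "y \<in> ?D" for y
    proof -
      have "g E z = g E' z" if "z \<in> E `` {y}" for z
      proof (rule eq(2))
        have "z \<in> nball E x (Suc (2 * R))" using nball_step[of y E x "2 * R" z] Dx \<open>y \<in> ?D\<close> that by auto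
        then show "z \<in> nball E x (2 * R + 2)" using nball_mono[of "Suc (2 * R)" "2 * R + 2" E x] by auto
      qed
      then show ?thesis unfolding free_colours_def nb[OF that, symmetric] by auto
    qed
    have "list_coloring E ?D (free_colours \<Delta> E (g E)) = list_coloring E' ?D (free_colours \<Delta> E' (g E'))"
      by (rule ext, rule list_coloring_cong) (use nb free in auto)
    then show ?thesis
      using False eq(1)[of x] unfolding finish_def v_def[symmetric] v'[symmetric] D by simp
  qed
qed

definition brooks_radius :: "nat \<Rightarrow> nat \<Rightarrow> nat" where
  "brooks_radius R K = K * (2 * R + 1) + (R + 1) + R + (3 * R + 1) + (3 * R + 2) * K + (2 * R + 2)"

lemma local_brooks:
  assumes "local_fun t \<kappa>"
  shows "local_fun (t + brooks_radius R K) (\<lambda>E. brooks \<Delta> R K E (\<kappa> E))"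
proof -
  define I where "I E = ruling (2 * R + 1) E (\<kappa> E) K" for E
  define Q where "Q E x \<longleftrightarrow> centres \<Delta> R E (I E) x \<noteq> {}" for E x
  define p where "p E x = (3 * R + 1 - depth (3 * R + 1) E (Q E) x) * K + \<kappa> E x" for E x
  define g where "g E = greedy E (p E) (Q E) ((3 * R + 2) * K)" for E
  define s1 where "s1 = K * (2 * R + 1) + (R + 1)"
  define s2 where "s2 = s1 + R"
  define s3 where "s3 = s2 + (3 * R + 1)"
  define s4 where "s4 = s3 + (3 * R + 2) * K"
  have "local_fun (t + K * (2 * R + 1)) (\<lambda>E x. x \<in> I E)"
    unfolding I_def by (rule local_ruling[OF assms])
  then have I: "local_fun (t + s1) (\<lambda>E x. x \<in> I E)" by (rule local_fun_mono) (simp add: s1_def)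
  have "R + 1 \<le> t + s1" by (simp add: s1_def)
  from local_centres[OF I this] have c: "local_fun (t + s2) (\<lambda>E. centres \<Delta> R E (I E))"
    by (simp add: s2_def add.assoc)
  then have Q: "local_fun (t + s2) Q" unfolding local_fun_def Q_def by simp
  from local_depth[OF this, of "3 * R + 1"]
  have d: "local_fun (t + s3) (\<lambda>E. depth (3 * R + 1) E (Q E))" by (simp add: s3_def add.assoc)
  have "local_fun (t + s3) \<kappa>" using local_fun_mono[OF assms] by simp
  with d have p: "local_fun (t + s3) p" unfolding local_fun_def p_def by simp
  have Q': "local_fun (t + s3) Q" using local_fun_mono[OF Q] by (simp add: s3_def)
  from local_greedy[OF p Q'] have g: "local_fun (t + s4) g"
    unfolding g_def s4_def by (simp add: add.assoc)
  have c4: "local_fun (t + s4) (\<lambda>E. centres \<Delta> R E (I E))"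
    using local_fun_mono[OF c] by (simp add: s3_def s4_def)
  have "R + 1 \<le> t + s4" by (simp add: s1_def s2_def s3_def s4_def)
  from local_finish[OF c4 g this]
  have fin: "local_fun (t + s4 + (2 * R + 2)) (\<lambda>E. finish \<Delta> R E (I E) (g E))" .
  have eq: "finish \<Delta> R E (I E) (g E) = brooks \<Delta> R K E (\<kappa> E)" for E
    unfolding brooks_def Let_def g_def p_def Q_def I_def ..
  have "t + s4 + (2 * R + 2) = t + brooks_radius R K"
    unfolding brooks_radius_def s1_def s2_def s3_def s4_def by simp
  then show ?thesis using fin unfolding eq by (simp only:)
qed

subsection \<open>Correctness\<close>

locale coloured_graph = simple_graph +
  fixes \<kappa> :: "'a \<Rightarrow> nat" and \<Delta> R K :: nat
  assumes degree: "card (E `` {x}) \<le> \<Delta>"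
    and ex_core: "\<exists>D \<subseteq> nball E v R. core \<Delta> E D"
    and \<kappa>_less: "\<kappa> x < K"
    and \<kappa>_proper: "y \<in> nball E x (2 * R + 1) \<Longrightarrow> x \<noteq> y \<Longrightarrow> \<kappa> x \<noteq> \<kappa> y"
begin

definition "I = ruling (2 * R + 1) E \<kappa> K"
definition "Q x \<longleftrightarrow> centres \<Delta> R E I x \<noteq> {}"
definition "lev = depth (3 * R + 1) E Q"
definition "prio x = (3 * R + 1 - lev x) * K + \<kappa> x"
definition "G = greedy E prio Q"
definition "g = G ((3 * R + 2) * K)"

lemma brooks_eq: "brooks \<Delta> R K E \<kappa> = finish \<Delta> R E I g"
proof -
  have "prio = (\<lambda>x. (3 * R + 1 - lev x) * K + \<kappa> x)" "Q = (\<lambda>x. centres \<Delta> R E I x \<noteq> {})"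
    by (rule ext, simp add: prio_def Q_def)+
  then show ?thesis unfolding brooks_def Let_def g_def G_def I_def lev_def by simp
qed

lemma core_at: "core_at \<Delta> R E v \<subseteq> nball E v R" "core \<Delta> E (core_at \<Delta> R E v)"
  using someI_ex[OF ex_core[of v]] ex_core[of v] unfolding core_at_def by auto

lemma ruling_separated:
  "x \<in> ruling (2 * R + 1) E \<kappa> j \<Longrightarrow> y \<in> ruling (2 * R + 1) E \<kappa> j \<Longrightarrow>
    y \<in> nball E x (2 * R + 1) \<Longrightarrow> x = y"
proof (induction j)
  case (Suc j)
  show ?case
  proof (cases "x \<in> ruling (2 * R + 1) E \<kappa> j \<longleftrightarrow> y \<in> ruling (2 * R + 1) E \<kappa> j")
    case True
    then show ?thesis using Suc \<kappa>_proper[OF Suc.prems(3)] by auto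
  next
    case False
    then show ?thesis using Suc.prems nball_sym[OF Suc.prems(3)] by auto
  qed
qed simp

lemma ruling_mono: "j \<le> k \<Longrightarrow> ruling r E \<kappa> j \<subseteq> ruling r E \<kappa> k"
  by (induction rule: dec_induct) auto

lemma ruling_dominates: "nball E x (2 * R + 1) \<inter> I \<noteq> {}"
proof -
  have "nball E x (2 * R + 1) \<inter> ruling (2 * R + 1) E \<kappa> (Suc (\<kappa> x)) \<noteq> {}"
    using nball_center[of x E "2 * R + 1"] by auto
  moreover have "ruling (2 * R + 1) E \<kappa> (Suc (\<kappa> x)) \<subseteq> I"
    unfolding I_def using \<kappa>_less[of x] by (intro ruling_mono) simp
  ultimately show ?thesis by blast
qed

text \<open>The two centres are within \<open>R + 1 + R\<close> of each other, which the ruling set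
  forbids for distinct members. With \<open>y = x\<close> this fixes the core of a vertex; along an
  edge it makes different cores nonadjacent.\<close>

lemma centre_unique:
  assumes "v \<in> centres \<Delta> R E I x" "w \<in> centres \<Delta> R E I y" "y \<in> nball E x 1"
  shows "v = w"
proof -
  have v: "v \<in> I" "v \<in> nball E x R" and w: "w \<in> I" "w \<in> nball E y R"
    using assms(1,2) by (auto simp: centres_def)
  have "y \<in> nball E v (R + 1)" using nball_trans[OF nball_sym[OF v(2)] assms(3)] .
  from nball_trans[OF this w(2)] have "w \<in> nball E v (2 * R + 1)" by (simp add: mult_2 add.commute add.left_commute)
  with ruling_separated[of v K w] v(1) w(1) show ?thesis unfolding I_def by blast
qed

lemma centresI: "v \<in> I \<Longrightarrow> x \<in> core_at \<Delta> R E v \<Longrightarrow> v \<in> centres \<Delta> R E I x"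
  using core_at(1)[of v] nball_sym[of x v R] unfolding centres_def by auto

section \<open>Levels and priorities of the greedy phase\<close>

lemma lev_le: "lev x \<le> 3 * R + 1"
  unfolding lev_def depth_def by (rule Least_le) simp

lemma lev_le_if: "lev x \<le> j" if "y \<in> nball E x j" "Q y"
  unfolding lev_def depth_def by (rule Least_le) (use that in blast)

text \<open>A ruling vertex within \<open>2 * R + 1\<close> has a nonempty core within a further
  \<open>R\<close>, so the cap \<open>3 * R + 1\<close> cuts off nothing.\<close>

lemma lev_witness: "\<exists>y\<in>nball E x (lev x). Q y"
proof -
  obtain v where v: "v \<in> nball E x (2 * R + 1)" "v \<in> I" using ruling_dominates[of x] by blast
  obtain y where y: "y \<in> core_at \<Delta> R E v" using core_at(2)[of v] unfolding core_def by blast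
  have "y \<in> nball E x (2 * R + 1 + R)" using nball_trans[OF v(1)] y core_at(1)[of v] by blast
  then have "y \<in> nball E x (3 * R + 1)" by (simp add: algebra_simps)
  moreover have "Q y" using centresI[OF v(2) y] unfolding Q_def by blast
  ultimately have *: "\<exists>y\<in>nball E x (3 * R + 1). Q y" by blast
  have "lev x = 3 * R + 1 \<or> (\<exists>y\<in>nball E x (lev x). Q y)"
    unfolding lev_def depth_def by (rule LeastI[of _ "3 * R + 1"]) simp
  with * show ?thesis by metis
qed

lemma ex_closer_neighbour:
  assumes "\<not> Q x"
  obtains y where "(x, y) \<in> E" "lev y < lev x"
proof -
  obtain z where z: "z \<in> nball E x (lev x)" "Q z" using lev_witness by blast
  have "lev x \<noteq> 0"
  proof
    assume "lev x = 0"
    then have "z = x" using z(1) by simp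
    then show False using z(2) assms by blast
  qed
  then obtain j where j: "lev x = Suc j" using not0_implies_Suc by blast
  have "z \<noteq> x" using z(2) assms by blast
  moreover have "z \<in> nball E x (Suc j)" using z(1) j by simp
  ultimately obtain y where y: "(x, y) \<in> E" "z \<in> nball E y j"
    unfolding nball_Suc_front by blast
  have "lev y \<le> j" using lev_le_if[OF y(2) z(2)] .
  with y(1) j that show ?thesis by simp
qed

lemma prio_less:
  assumes "lev y < lev x" shows "prio x < prio y"
proof -
  have "3 * R + 1 - lev x + 1 \<le> 3 * R + 1 - lev y" using assms lev_le[of x] by linarith
  then have "(3 * R + 1 - lev x + 1) * K \<le> (3 * R + 1 - lev y) * K" by (rule mult_le_mono1)
  then show ?thesis using \<kappa>_less[of x] unfolding prio_def by simp
qed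

lemma prio_proper: "(x, y) \<in> E \<Longrightarrow> prio x \<noteq> prio y"
proof
  assume xy: "(x, y) \<in> E" and eq: "prio x = prio y"
  have "prio z mod K = \<kappa> z" for z using \<kappa>_less[of z] by (simp add: prio_def)
  then have "\<kappa> x = \<kappa> y" using eq by metis
  moreover have "y \<in> nball E x 1" using xy by (auto simp: nball.simps)
  then have "y \<in> nball E x (2 * R + 1)" using nball_mono[of 1 "2 * R + 1" E x] by auto
  moreover have "x \<noteq> y" using xy E_irrefl by blast
  ultimately show False using \<kappa>_proper by blast
qed

lemma prio_bound: "prio x < (3 * R + 2) * K"
proof -
  have "(3 * R + 1 - lev x) * K \<le> (3 * R + 1) * K" by (rule mult_le_mono1) simp
  then show ?thesis using \<kappa>_less[of x] unfolding prio_def by (simp add: algebra_simps)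
qed

lemma G_None: "j \<le> prio x \<or> Q x \<Longrightarrow> G j x = None"
  unfolding G_def by (induction j) auto

lemma G_Some:
  assumes "\<not> Q x" "prio x < j"
  shows "G j x = Some (LEAST c. \<forall>y\<in>E `` {x}. G (prio x) y \<noteq> Some c)"
  using assms(2)
proof (induction j)
  case (Suc j)
  then show ?case using assms(1) unfolding G_def by (cases "j = prio x") auto
qed simp

text \<open>A neighbour closer to the cores is still uncoloured when \<open>x\<close> is treated:
  its turn comes later or, inside a core, never. So at most \<open>\<Delta> - 1\<close> colours are
  blocked.\<close>

lemma g_colour:
  assumes "\<not> Q x"
  obtains c where "g x = Some c" "c < \<Delta>" "\<And>y. (x, y) \<in> E \<Longrightarrow> prio y < prio x \<Longrightarrow> g y \<noteq> Some c"
proof -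
  let ?N = "{c. \<exists>y\<in>E `` {x}. G (prio x) y = Some c}"
  define c where "c = (LEAST c. \<forall>y\<in>E `` {x}. G (prio x) y \<noteq> Some c)"
  obtain y0 where y0: "(x, y0) \<in> E" "lev y0 < lev x" using ex_closer_neighbour[OF assms] .
  have "G (prio x) y0 = None" using prio_less[OF y0(2)] by (intro G_None) simp
  then have "?N \<subseteq> (\<lambda>y. the (G (prio x) y)) ` (E `` {x} - {y0})" by force
  then have "card ?N \<le> card (E `` {x} - {y0})"
    using finite_neighbours by (intro surj_card_le) auto
  also have "\<dots> < card (E `` {x})" using y0(1) finite_neighbours by (intro card_Diff1_less) auto
  also have "\<dots> \<le> \<Delta>" by (rule degree)
  finally have "card ?N < card {..<\<Delta>}" by simp
  moreover have "finite ?N"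
    using \<open>?N \<subseteq> _\<close> finite_neighbours by (meson finite_Diff finite_imageI finite_subset)
  ultimately have "\<not> {..<\<Delta>} \<subseteq> ?N" using card_mono[of ?N "{..<\<Delta>}"] by linarith
  then obtain c' where c': "c' < \<Delta>" "\<forall>y\<in>E `` {x}. G (prio x) y \<noteq> Some c'" by blast
  have "c \<le> c'" unfolding c_def using c'(2) by (rule Least_le)
  moreover have c: "\<forall>y\<in>E `` {x}. G (prio x) y \<noteq> Some c" unfolding c_def using c'(2) by (rule LeastI)
  moreover have "g x = Some c" unfolding c_def g_def using G_Some[OF assms prio_bound] .
  moreover have "g y \<noteq> Some c" if y: "(x, y) \<in> E" "prio y < prio x" for y
  proof (cases "Q y")
    case True
    then show ?thesis using G_None by (simp add: g_def)
  next
    case False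
    then have "g y = G (prio x) y" using G_Some[OF False prio_bound] G_Some[OF False y(2)] by (simp add: g_def)
    then show ?thesis using c y(1) by auto
  qed
  ultimately show ?thesis using that c'(1) by (meson le_less_trans)
qed

lemma g_proper:
  assumes "(x, y) \<in> E" "\<not> Q x" "\<not> Q y"
  shows "g x \<noteq> g y"
proof (cases "prio y < prio x")
  case True
  then show ?thesis using g_colour[OF assms(2)] assms(1) by metis
next
  case False
  then have "prio x < prio y" using prio_proper[OF assms(1)] by simp
  then show ?thesis using g_colour[OF assms(3)] E_sym[OF assms(1)] by metis
qed

text \<open>\<open>g\<close> leaves the core uncoloured, so only neighbours outside it block
  colours; this is the list size that \<open>core\<close> asks for. The choice inside
  \<open>finish\<close> returns \<open>v\<close> because centres are unique.\<close>

lemma finish_core: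
  assumes v: "v \<in> I"
  defines "\<phi> \<equiv> SOME \<phi>. list_coloring E (core_at \<Delta> R E v) (free_colours \<Delta> E g) \<phi>"
  shows "list_coloring E (core_at \<Delta> R E v) (free_colours \<Delta> E g) \<phi>"
    and "x \<in> core_at \<Delta> R E v \<Longrightarrow> finish \<Delta> R E I g x = \<phi> x"
proof -
  let ?D = "core_at \<Delta> R E v"
  have "finite (free_colours \<Delta> E g x) \<and>
      degree_in E ?D x + \<Delta> \<le> card (free_colours \<Delta> E g x) + card (E `` {x})" for x
  proof -
    let ?U = "{c. \<exists>z\<in>E `` {x}. g z = Some c}"
    have "g z = None" if "z \<in> ?D" for z
      unfolding g_def using centresI[OF v that] by (intro G_None) (auto simp: Q_def)
    then have sub: "?U \<subseteq> (\<lambda>z. the (g z)) ` (E `` {x} - ?D)" by force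
    have fin: "finite (E `` {x} - ?D)" using finite_neighbours by simp
    have fU: "finite ?U" by (rule finite_subset[OF sub finite_imageI[OF fin]])
    have "card ?U \<le> card (E `` {x} - ?D)" by (rule surj_card_le[OF fin sub])
    moreover have "card (E `` {x}) = degree_in E ?D x + card (E `` {x} - ?D)"
      using card_Int_Diff[of "E `` {x}" ?D] finite_neighbours by (simp add: degree_in_def)
    moreover have "\<Delta> - card ?U \<le> card (free_colours \<Delta> E g x)"
      using diff_card_le_card_Diff[OF fU, of "{..<\<Delta>}"] unfolding free_colours_def by simp
    ultimately show ?thesis unfolding free_colours_def by auto
  qed
  then have "\<exists>\<phi>. list_coloring E ?D (free_colours \<Delta> E g) \<phi>"
    using core_at(2)[of v] unfolding core_def by blast
  then show "list_coloring E ?D (free_colours \<Delta> E g) \<phi>" unfolding \<phi>_def by (rule someI_ex)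
  assume "x \<in> ?D"
  then have vx: "v \<in> centres \<Delta> R E I x" using centresI v by blast
  then have "(SOME w. w \<in> centres \<Delta> R E I x) \<in> centres \<Delta> R E I x" by (rule someI)
  then have "(SOME w. w \<in> centres \<Delta> R E I x) = v" using centre_unique[OF _ vx] by simp
  then show "finish \<Delta> R E I g x = \<phi> x" using vx unfolding finish_def \<phi>_def by auto
qed

lemma finish_outside:
  assumes "\<not> Q x" shows "g x = Some (finish \<Delta> R E I g x)"
proof -
  obtain c where "g x = Some c" by (rule g_colour[OF assms])
  moreover have "finish \<Delta> R E I g x = the (g x)" using assms unfolding finish_def Q_def by simp
  ultimately show ?thesis by simp
qed

lemma finish_inside:
  assumes "Q x"
  obtains v \<phi> where "v \<in> I" "x \<in> core_at \<Delta> R E v"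
    "list_coloring E (core_at \<Delta> R E v) (free_colours \<Delta> E g) \<phi>"
    "\<forall>y\<in>core_at \<Delta> R E v. finish \<Delta> R E I g y = \<phi> y"
proof -
  obtain v where v: "v \<in> I" "x \<in> core_at \<Delta> R E v" using assms unfolding Q_def centres_def by blast
  show ?thesis by (rule that[OF v finish_core(1)[OF v(1)]]) (use finish_core(2)[OF v(1)] in blast)
qed

lemma brooks_less: "brooks \<Delta> R K E \<kappa> x < \<Delta>"
proof (cases "Q x")
  case True
  obtain v \<phi> where "v \<in> I" "x \<in> core_at \<Delta> R E v"
    "list_coloring E (core_at \<Delta> R E v) (free_colours \<Delta> E g) \<phi>"
    "\<forall>y\<in>core_at \<Delta> R E v. finish \<Delta> R E I g y = \<phi> y"
    using finish_inside[OF True] .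
  then show ?thesis unfolding brooks_eq list_coloring_def free_colours_def by auto
next
  case False
  obtain c where "g x = Some c" "c < \<Delta>" by (rule g_colour[OF False])
  with finish_outside[OF False] show ?thesis unfolding brooks_eq by simp
qed

lemma brooks_proper_aux:
  assumes "(x, y) \<in> E" "Q x"
  shows "finish \<Delta> R E I g x \<noteq> finish \<Delta> R E I g y"
proof -
  obtain v \<phi> where v: "v \<in> I" "x \<in> core_at \<Delta> R E v"
    and \<phi>: "list_coloring E (core_at \<Delta> R E v) (free_colours \<Delta> E g) \<phi>"
      "\<forall>y\<in>core_at \<Delta> R E v. finish \<Delta> R E I g y = \<phi> y"
    using finish_inside[OF assms(2)] .
  show ?thesis
  proof (cases "Q y")
    case True
    then obtain w where w: "w \<in> centres \<Delta> R E I y" unfolding Q_def by blast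
    moreover have "y \<in> nball E x 1" using assms(1) by (auto simp: nball.simps)
    ultimately have "v = w" using centre_unique[OF centresI[OF v]] by blast
    then have "y \<in> core_at \<Delta> R E v" using w by (simp add: centres_def)
    with \<phi> v assms(1) show ?thesis unfolding list_coloring_def by simp
  next
    case False
    have "\<phi> x \<in> free_colours \<Delta> E g x" using \<phi>(1) v(2) unfolding list_coloring_def by blast
    then show ?thesis
      using finish_outside[OF False] assms(1) bspec[OF \<phi>(2) v(2)] unfolding free_colours_def by auto
  qed
qed

lemma brooks_proper:
  assumes "(x, y) \<in> E"
  shows "brooks \<Delta> R K E \<kappa> x \<noteq> brooks \<Delta> R K E \<kappa> y"
proof (cases "Q x \<or> Q y")
  case True
  then show ?thesis
    using brooks_proper_aux[OF assms] brooks_proper_aux[OF E_sym[OF assms]] unfolding brooks_eq by metis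
next
  case False
  then show ?thesis
    using g_proper[OF assms] finish_outside[of x] finish_outside[of y] unfolding brooks_eq by metis
qed

end

subsection \<open>Existence of cores\<close>

text \<open>A vertex of degree below \<open>\<Delta>\<close> is a core by itself, and a
  degree-choosable set is one because degrees are at most \<open>\<Delta>\<close>. The bound
  \<open>small\<close> is asked only at non-isolated \<open>v\<close>, since an isolated point may
  lie outside the graph, where the growth bound says nothing.\<close>

lemma (in simple_graph) ex_core:
  assumes "3 \<le> \<Delta>" and degree: "\<And>x. card (E `` {x}) \<le> \<Delta>"
    and no_clique: "\<And>Q. card Q = \<Delta> + 1 \<Longrightarrow> \<not> clique E Q"
    and small: "E `` {v} \<noteq> {} \<Longrightarrow> card (nball E v (2 * k + 2)) < 2 ^ k"
  shows "\<exists>D \<subseteq> nball E v (2 * k + 2). core \<Delta> E D"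
proof (rule ccontr)
  assume none: "\<not> ?thesis"
  have regular: "card (E `` {x}) = \<Delta>" if x: "x \<in> nball E v (2 * k + 2)" for x
  proof (rule ccontr)
    assume "card (E `` {x}) \<noteq> \<Delta>"
    then have less: "card (E `` {x}) < \<Delta>" using degree[of x] by simp
    have "core \<Delta> E {x}"
      unfolding core_def
    proof (intro conjI allI impI)
      fix L :: "'a \<Rightarrow> nat set"
      assume L: "\<forall>y\<in>{x}. finite (L y) \<and> degree_in E {x} y + \<Delta> \<le> card (L y) + card (E `` {y})"
      then have "L x \<noteq> {}" using less by auto
      then obtain c where "c \<in> L x" by blast
      then have "list_coloring E {x} L (\<lambda>_. c)" using E_irrefl by (simp add: list_coloring_def)
      then show "\<exists>\<phi>. list_coloring E {x} L \<phi>" by (rule exI[of _ "\<lambda>_. c"])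
    qed auto
    with none x show False by blast
  qed
  have "\<not> degree_choosable E D" if D: "D \<subseteq> nball E v (2 * k + 2)" for D
  proof
    assume dc: "degree_choosable E D"
    have "core \<Delta> E D"
      unfolding core_def
    proof (intro conjI allI impI)
      show "D \<noteq> {}" "finite D" using dc by (auto simp: degree_choosable_def)
      fix L :: "'a \<Rightarrow> nat set"
      assume L: "\<forall>x\<in>D. finite (L x) \<and> degree_in E D x + \<Delta> \<le> card (L x) + card (E `` {x})"
      have "degree_in E D x \<le> card (L x)" if "x \<in> D" for x
        using L[rule_format, OF that] degree[of x] by linarith
      then have "\<forall>x\<in>D. finite (L x) \<and> degree_in E D x \<le> card (L x)" using L by blast
      then show "\<exists>\<phi>. list_coloring E D L \<phi>" using dc unfolding degree_choosable_def by blast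
    qed
    with none D show False by blast
  qed
  then interpret ball_without_core E v "2 * k + 2" \<Delta>
    using assms(1) regular no_clique by unfold_locales
  have "2 ^ k \<le> card (layer E v (2 * k + 2))" by (rule exponential_layer) simp
  also have "\<dots> \<le> card (nball E v (2 * k + 2))"
    by (intro card_mono) (auto dest: layer_in_nball)
  finally have "E `` {v} = {}" using small by linarith
  then show False using regular[of v] assms(1) by simp
qed

lemma subexponential_radius:
  assumes "subexponential f"
  obtains k where "f (2 * k + 2) \<le> 2 ^ k"
proof -
  \<comment> \<open>With \<open>1 / 4\<close>, two steps cost the factor \<open>25 / 16 < 2\<close>;
    the constant \<open>16 / 25\<close> cancels the offset \<open>+ 2\<close>.\<close>
  have "(\<lambda>n. real (f n)) \<in> o(\<lambda>n. (1 + 1 / 4 :: real) ^ n)"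
    using assms unfolding subexponential_def by (elim allE[of _ "1 / 4"]) simp
  from landau_o.smallD[OF this, of "16 / 25"]
  have "eventually (\<lambda>n. real (f n) \<le> 16 / 25 * (5 / 4) ^ n) at_top" by simp
  then obtain N where N: "\<And>n. n \<ge> N \<Longrightarrow> real (f n) \<le> 16 / 25 * (5 / 4) ^ n"
    unfolding eventually_at_top_linorder by blast
  have "real (f (2 * N + 2)) \<le> 16 / 25 * (5 / 4) ^ (2 * N + 2)" by (rule N) simp
  also have "\<dots> = (25 / 16) ^ N" by (simp add: power_add power_mult power2_eq_square)
  also have "\<dots> \<le> 2 ^ N" by (rule power_mono) auto
  finally have "real (f (2 * N + 2)) \<le> real (2 ^ N)" by simp
  then have "f (2 * N + 2) \<le> 2 ^ N" by (simp only: of_nat_le_iff)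
  then show ?thesis using that by blast
qed

subsection \<open>The number of reduction rounds\<close>

lemma iterated_log_gt_2: "i < log_star n \<Longrightarrow> 2 < (log 2 ^^ i) (real n)"
  using not_less_Least[of i "\<lambda>k. (log 2 ^^ k) (real n) \<le> 2"] unfolding log_star_def by simp

text \<open>A round turns a bound \<open>C * y\<close> into
  \<open>d * (log 2 (4 * C * y) + 1)\<close>. The choice of \<open>C\<close> gives
  \<open>log 2 C = 2 * e + 4\<close> and \<open>e * (2 * e + 8) \<le> C\<close>, and while
  \<open>i < log_star n\<close> the term \<open>log 2 y\<close> is at least 1 and absorbs the
  additive constants. Starting from \<open>a * n\<close> bits, linear in \<open>n\<close>, lets the
  iteration run in step with \<open>log_star\<close>.\<close>

lemma bits_le_iterated_log:
  assumes C: "C = 2 ^ (2 * e + 4)" and e: "d \<le> e" "a \<le> e" and n: "1 \<le> n"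
  shows "i \<le> log_star n \<Longrightarrow>
    1 \<le> (log 2 ^^ i) (real n) \<and> real (bits d (a * n) i) \<le> real C * (log 2 ^^ i) (real n)"
proof (induction i)
  case 0
  have "e \<le> C"
    unfolding C using less_exp[of e] power_increasing[of e "2 * e + 4" "2 :: nat"] by linarith
  then have "a * n \<le> C * n" using e by simp
  then have "real (a * n) \<le> real (C * n)" by (simp only: of_nat_le_iff)
  then show ?case using n by simp
next
  case (Suc i)
  define y where "y = (log 2 ^^ i) (real n)"
  define b where "b = bits d (a * n) i"
  have y2: "2 < y" unfolding y_def using Suc.prems by (intro iterated_log_gt_2) simp
  have IH: "real b \<le> real C * y" using Suc unfolding y_def b_def by simp
  have ly: "1 \<le> log 2 y" using y2 by (subst le_log_iff) auto
  have C1: "1 \<le> real C" unfolding C by simp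
  then have "1 \<le> real C * y" using y2 by (smt (verit) mult_less_cancel_right2)
  then have "real (2 * b + 1) \<le> 4 * (real C * y)" using IH by simp
  then have "log 2 (real (2 * b + 1)) \<le> log 2 (4 * (real C * y))"
    using \<open>1 \<le> real C * y\<close> by (subst log_le_cancel_iff) auto
  also have "\<dots> = 2 + (real (2 * e + 4) + log 2 y)"
  proof -
    have "log 2 (4 :: real) = log 2 (2 ^ 2)" by simp
    also have "\<dots> = 2" by (subst log_nat_power) auto
    finally have "log 2 (4 :: real) = 2" .
    moreover have "log 2 (real C) = real (2 * e + 4)"
      unfolding C by (simp add: log_nat_power)
    ultimately show ?thesis using C1 y2 by (simp add: log_mult)
  qed
  finally have l: "log 2 (real (2 * b + 1)) \<le> real (2 * e + 6) + log 2 y" by simp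
  have "0 \<le> log 2 (real (2 * b + 1))" by simp
  then have "real (nat \<lceil>log 2 (real (2 * b + 1))\<rceil>) \<le> log 2 (real (2 * b + 1)) + 1" by linarith
  also have "\<dots> \<le> real (2 * e + 7) + log 2 y" using l by simp
  also have "\<dots> \<le> real (2 * e + 8) * log 2 y"
  proof -
    have "real (2 * e + 7) * 1 \<le> real (2 * e + 7) * log 2 y" using ly by (intro mult_left_mono) auto
    then show ?thesis by (simp add: algebra_simps)
  qed
  finally have X: "real (nat \<lceil>log 2 (real (2 * b + 1))\<rceil>) \<le> real (2 * e + 8) * log 2 y" .
  have "real d * real (nat \<lceil>log 2 (real (2 * b + 1))\<rceil>) \<le> real e * (real (2 * e + 8) * log 2 y)"
    by (rule mult_mono[OF _ X]) (simp_all only: of_nat_0_le_iff of_nat_le_iff e)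
  also have "\<dots> = real (e * (2 * e + 8)) * log 2 y" by simp
  also have "\<dots> \<le> real C * log 2 y"
  proof -
    define P :: nat where "P = 2 ^ e"
    have "e < P" unfolding P_def by (rule less_exp)
    then have "2 * e + 8 \<le> 16 * P" by linarith
    then have "e * (2 * e + 8) \<le> P * (16 * P)" using \<open>e < P\<close> by (intro mult_mono) auto
    also have "\<dots> = P * P * 2 ^ 4" by simp
    also have "\<dots> = C" unfolding C P_def by (simp only: power_add mult_2)
    finally have "real (e * (2 * e + 8)) \<le> real C" by (simp only: of_nat_le_iff)
    then show ?thesis using ly by (intro mult_right_mono) auto
  qed
  finally have "real (bits d (a * n) (Suc i)) \<le> real C * log 2 y" by (simp add: b_def)
  then show ?case using ly by (simp add: y_def)
qed

subsection \<open>From views to algorithms\<close>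

definition encoded_view :: "(nat \<times> nat) set \<Rightarrow> nat \<Rightarrow> nat \<Rightarrow> local_view" where
  "encoded_view E t x = (x, \<lparr> pverts = nball E x t, parcs = E \<inter> nball E x t \<times> nball E x t \<rparr>)"

text \<open>The output is taken from any relation that shows the given view; locality makes the
  value independent of which one.\<close>

lemma local_fun_algorithm:
  assumes "\<And>n. local_fun (t n) (\<Phi> n)"
  shows "\<exists>A :: 'o local_algorithm. \<forall>n E x. A n (encoded_view E (t n) x) = \<Phi> n E x"
proof -
  define A where "A n w = (SOME out. \<exists>E x. w = encoded_view E (t n) x \<and> out = \<Phi> n E x)" for n w
  have "A n (encoded_view E (t n) x) = \<Phi> n E x" for n E x
    unfolding A_def
  proof (rule some_equality)
    fix out assume "\<exists>E' x'. encoded_view E (t n) x = encoded_view E' (t n) x' \<and> out = \<Phi> n E' x'"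
    then obtain E' where "same_view E E' (t n) x" "out = \<Phi> n E' x"
      unfolding encoded_view_def same_view_def by auto
    then show "out = \<Phi> n E x" using assms[of n] unfolding local_fun_def by metis
  qed blast
  then show ?thesis by blast
qed

lemma graph_ball_eq_nball:
  assumes "pair_wf_digraph G" "v \<in> pverts G"
  shows "graph_ball G v r = nball (parcs G) v r"
proof -
  interpret pair_wf_digraph G by fact
  have "(\<exists>p. awalk v p u \<and> length p \<le> r) \<longleftrightarrow> u \<in> nball (parcs G) v r" if "v \<in> pverts G" for u v
    using that
  proof (induction r arbitrary: v)
    case 0
    then show ?case by (auto simp: awalk_Nil_iff)
  next
    case (Suc r)
    have "(\<exists>p. awalk v p u \<and> length p \<le> Suc r) \<longleftrightarrow>
        u = v \<or> (\<exists>y. (v, y) \<in> parcs G \<and> (\<exists>p. awalk y p u \<and> length p \<le> r))"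
    proof
      assume "\<exists>p. awalk v p u \<and> length p \<le> Suc r"
      then obtain p where p: "awalk v p u" "length p \<le> Suc r" by blast
      show "u = v \<or> (\<exists>y. (v, y) \<in> parcs G \<and> (\<exists>p. awalk y p u \<and> length p \<le> r))"
      proof (cases p)
        case Nil
        then show ?thesis using p by (simp add: awalk_Nil_iff)
      next
        case (Cons e es)
        then have "e \<in> parcs G" "v = fst e" "awalk (snd e) es u" "length es \<le> r"
          using p by (auto simp: awalk_Cons_iff)
        then show ?thesis by (metis prod.collapse)
      qed
    next
      assume "u = v \<or> (\<exists>y. (v, y) \<in> parcs G \<and> (\<exists>p. awalk y p u \<and> length p \<le> r))"
      then show "\<exists>p. awalk v p u \<and> length p \<le> Suc r"
      proof
        assume "u = v"
        then have "awalk v [] u" using Suc.prems by (simp add: awalk_Nil_iff)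
        then show ?thesis by (metis le0 list.size(3))
      next
        assume "\<exists>y. (v, y) \<in> parcs G \<and> (\<exists>p. awalk y p u \<and> length p \<le> r)"
        then obtain y p where yp: "(v, y) \<in> parcs G" "awalk y p u" "length p \<le> r" by blast
        then have "awalk v ((v, y) # p) u" by (simp add: awalk_Cons_iff)
        moreover have "length ((v, y) # p) \<le> Suc r" using yp(3) by simp
        ultimately show ?thesis by blast
      qed
    qed
    also have "\<dots> \<longleftrightarrow> u \<in> nball (parcs G) v (Suc r)"
      unfolding nball_Suc_front using Suc.IH in_arcsD2 by auto
    finally show ?case .
  qed
  then show ?thesis using graph_ball_iff_awalk[OF assms(1)] assms(2) by blast
qed

section \<open>The graph on its identifiers\<close>

locale identified_graph = pair_graph G for G :: "'a pair_pre_digraph" +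
  fixes ident :: "'a \<Rightarrow> nat"
  assumes inj: "inj_on ident (pverts G)"
begin

definition "E = map_prod ident ident ` parcs G"

lemma E_in:
  assumes "(a, b) \<in> E"
  obtains x y where "x \<in> pverts G" "y \<in> pverts G" "(x, y) \<in> parcs G" "a = ident x" "b = ident y"
proof -
  obtain x y where "(x, y) \<in> parcs G" "a = ident x" "b = ident y" using assms unfolding E_def by auto
  then show ?thesis using that in_arcsD1 in_arcsD2 by blast
qed

lemma E_iff:
  assumes "x \<in> pverts G" "y \<in> pverts G"
  shows "(ident x, ident y) \<in> E \<longleftrightarrow> (x, y) \<in> parcs G"
proof
  assume "(ident x, ident y) \<in> E"
  then show "(x, y) \<in> parcs G" by (rule E_in) (use assms inj in \<open>auto dest: inj_onD\<close>)
next
  assume "(x, y) \<in> parcs G"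
  then show "(ident x, ident y) \<in> E" unfolding E_def by (rule rev_image_eqI) simp
qed

lemma neighbours:
  assumes "x \<in> pverts G" shows "E `` {ident x} = ident ` (parcs G `` {x})"
proof (intro equalityI subsetI)
  fix b assume "b \<in> E `` {ident x}"
  then have "(ident x, b) \<in> E" by simp
  then show "b \<in> ident ` (parcs G `` {x})" by (rule E_in) (use assms inj in \<open>auto dest: inj_onD\<close>)
next
  fix b assume "b \<in> ident ` (parcs G `` {x})"
  then show "b \<in> E `` {ident x}" using E_iff[OF assms] in_arcsD2 by auto
qed

sublocale simple_graph E
proof
  show "(y, x) \<in> E" if "(x, y) \<in> E" for x y
    using that by (rule E_in) (use E_iff arcs_symmetric in blast)
  show "(x, x) \<notin> E" for x
  proof
    assume "(x, x) \<in> E"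
    then show False by (rule E_in) (use inj pair_no_loops in \<open>metis fst_conv inj_onD snd_conv\<close>)
  qed
  show "finite (E `` {x})" for x
    unfolding E_def by (rule finite_Image) (simp add: pair_finite_arcs)
qed

lemma nball_E: "v \<in> pverts G \<Longrightarrow> nball E (ident v) r = ident ` nball (parcs G) v r"
proof (induction r arbitrary: v)
  case (Suc r)
  have "nball E (ident v) (Suc r) = {ident v} \<union> (\<Union>y\<in>parcs G `` {v}. nball E (ident y) r)"
    unfolding nball_Suc_front neighbours[OF Suc.prems] by simp
  also have "\<dots> = {ident v} \<union> (\<Union>y\<in>parcs G `` {v}. ident ` nball (parcs G) y r)"
    using Suc.IH in_arcsD2 by auto
  also have "\<dots> = ident ` nball (parcs G) v (Suc r)" unfolding nball_Suc_front by auto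
  finally show ?case .
qed simp

lemma nball_in: "v \<in> pverts G \<Longrightarrow> nball (parcs G) v r \<subseteq> pverts G"
  using graph_ball_eq_nball[OF pair_wf_digraph_axioms, of v r] unfolding graph_ball_def by blast

lemma local_view_eq: "v \<in> pverts G \<Longrightarrow> local_view G ident t v = encoded_view E t (ident v)"
proof -
  assume v: "v \<in> pverts G"
  let ?B = "nball (parcs G) v t"
  have B: "graph_ball G v t = ?B" using graph_ball_eq_nball[OF pair_wf_digraph_axioms v] .
  have "{(ident x, ident y) |x y. (x, y) \<in> parcs G \<and> x \<in> ?B \<and> y \<in> ?B} = E \<inter> (ident ` ?B) \<times> (ident ` ?B)"
    using nball_in[OF v, of t] E_iff by (auto; blast)
  then show ?thesis unfolding local_view_def encoded_view_def nball_E[OF v] B by simp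
qed

lemma card_nball:
  assumes "growth_bounded f G" "E `` {x} \<noteq> {}"
  shows "card (nball E x r) < f r"
proof -
  obtain v where v: "v \<in> pverts G" "x = ident v" using assms(2) by (blast elim: E_in)
  have "card (nball E x r) = card (nball (parcs G) v r)"
    unfolding v(2) nball_E[OF v(1)] using nball_in[OF v(1)] inj inj_on_subset card_image by metis
  also have "\<dots> < f r"
    using assms(1) v(1) graph_ball_eq_nball[OF pair_wf_digraph_axioms v(1)] unfolding growth_bounded_def by metis
  finally show ?thesis .
qed

text \<open>\<open>f\<close> bounds only balls around vertices; the summand 1 covers the singleton
  ball of a number that is no identifier.\<close>

lemma card_nball_le:
  assumes "growth_bounded f G"
  shows "card (nball E x r) \<le> f r + 1"
proof (cases "E `` {x} = {}")
  case True
  then have "nball E x r = {x}" by (induction r) (auto simp: nball.simps)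
  then show ?thesis by simp
next
  case False
  then show ?thesis using card_nball[OF assms False, of r] by simp
qed

lemma card_neighbours:
  assumes "\<forall>v \<in> pverts G. out_degree (with_proj G) v \<le> \<Delta>"
  shows "card (E `` {x}) \<le> \<Delta>"
proof (cases "E `` {x} = {}")
  case False
  then obtain v where v: "v \<in> pverts G" "x = ident v" by (blast elim: E_in)
  have fin: "finite (out_arcs (with_proj G) v)"
    by (rule finite_subset[OF _ pair_finite_arcs]) (auto simp: out_arcs_def)
  have "parcs G `` {v} = snd ` out_arcs (with_proj G) v" by (force simp: out_arcs_def)
  then have "E `` {x} = (ident \<circ> snd) ` out_arcs (with_proj G) v"
    unfolding v(2) neighbours[OF v(1)] by (simp add: image_comp)
  then have "card (E `` {x}) \<le> out_degree (with_proj G) v"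
    using card_image_le[OF fin] by (simp add: out_degree_def)
  with assms v(1) show ?thesis by force
qed simp

lemma clique_free:
  assumes "\<not> (\<exists>H. subgraph H (with_proj G) \<and> complete_digraph (\<Delta> + 1) H)" "1 \<le> \<Delta>" "card Q = \<Delta> + 1"
  shows "\<not> clique E Q"
proof
  assume cl: "clique E Q"
  have finQ: "finite Q" using assms(3) card.infinite by force
  have "Q \<subseteq> ident ` pverts G"
  proof
    fix a assume a: "a \<in> Q"
    have "\<not> Q \<subseteq> {a}" using card_mono[of "{a}" Q] assms(2,3) by auto
    then obtain b where "b \<in> Q" "a \<noteq> b" by blast
    then have "(a, b) \<in> E" using cl a unfolding clique_def by blast
    then show "a \<in> ident ` pverts G" by (blast elim: E_in)
  qed
  then obtain U where U: "U \<subseteq> pverts G" "Q = ident ` U" by (meson subset_imageE)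
  have inj_U: "inj_on ident U" using inj U(1) inj_on_subset by blast
  have cU: "card U = \<Delta> + 1" using card_image[OF inj_U] U(2) assms(3) by simp
  have fU: "finite U" using cU card.infinite by force
  define H where "H = \<lparr> pverts = U, parcs = {(u, w). (u, w) \<in> U \<times> U \<and> u \<noteq> w} \<rparr>"
  have "(u, w) \<in> parcs G" if "u \<in> U" "w \<in> U" "u \<noteq> w" for u w
  proof -
    have "ident u \<noteq> ident w" using inj_U that by (meson inj_onD)
    then have "(ident u, ident w) \<in> E" using cl that U(2) unfolding clique_def by blast
    then show ?thesis using E_iff that U(1) by blast
  qed
  then have arcs: "parcs H \<subseteq> parcs G" by (auto simp: H_def)
  have "complete_digraph (\<Delta> + 1) (with_proj H)"
    unfolding complete_digraph_pair_def using fU cU by (simp add: H_def)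
  moreover have "subgraph (with_proj H) (with_proj G)"
  proof -
    have "wf_digraph (with_proj H)" by unfold_locales (auto simp: H_def)
    then show ?thesis
      using arcs U(1) wf_digraph_axioms unfolding subgraph_def compatible_def by (simp add: H_def)
  qed
  ultimately show False using assms(1) by blast
qed

end

theorem mainTheorem6:
  fixes \<Delta> c :: nat
    and f :: "nat \<Rightarrow> nat"
    and F :: "'a pair_pre_digraph set"
  assumes "\<Delta> \<ge> 3"
    and "subexponential f"
    and "\<forall>G \<in> F. pair_graph G"
    and "\<forall>G \<in> F. growth_bounded f G"
    and "\<forall>G \<in> F. \<forall>v \<in> pverts G. out_degree (with_proj G) v \<le> \<Delta>"
    and "\<forall>G \<in> F. \<not> (\<exists>H. subgraph H (with_proj G) \<and> complete_digraph (\<Delta> + 1) H)"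
  shows "\<exists>(A :: nat local_algorithm) (t :: nat \<Rightarrow> nat).
    (\<lambda>n. real (t n)) \<in> O(\<lambda>n. real (log_star n)) \<and>
    (\<forall>G \<in> F. \<forall>ident. identifier_assignment c G ident \<longrightarrow>
      proper_coloring \<Delta> G (local_output A t G ident))"
proof -
  obtain k where k: "f (2 * k + 2) \<le> 2 ^ k" using subexponential_radius[OF assms(2)] .
  define R where "R = 2 * k + 2"
  \<comment> \<open>\<open>r\<close> is the separation used by \<open>brooks\<close>,
    \<open>d\<close> bounds the \<open>r\<close>-balls, \<open>e\<close> dominates \<open>d\<close>
    and \<open>c + 1\<close>, and the exponent of \<open>K\<close> is the bit bound
    \<open>C * 2\<close> left after \<open>log_star n\<close> rounds.\<close>
  define r where "r = 2 * R + 1"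
  define d where "d = f r + 1"
  define e where "e = max d (c + 1)"
  define C :: nat where "C = 2 ^ (2 * e + 4)"
  define K :: nat where "K = 2 ^ (2 * C)"
  \<comment> \<open>The reduction needs bounded initial colours at every natural number. Numbers
    above \<open>n ^ c\<close> are no identifiers, hence isolated, so their common default 0 causes
    no conflict.\<close>
  define \<kappa> :: "nat \<Rightarrow> (nat \<times> nat) set \<Rightarrow> nat \<Rightarrow> nat" where
    "\<kappa> n = reduced r d ((c + 1) * n) (\<lambda>x. if x \<le> n ^ c then x else 0) (log_star n)" for n
  define t where "t n = log_star n * r + brooks_radius R K" for n
  define \<Phi> where "\<Phi> n E = brooks \<Delta> R K E (\<kappa> n E)" for n E
  have "local_fun (t n) (\<Phi> n)" for n
    unfolding t_def \<Phi>_def by (rule local_brooks) (simp add: \<kappa>_def local_reduced)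
  then obtain A :: "nat local_algorithm" where A: "\<And>n E x. A n (encoded_view E (t n) x) = \<Phi> n E x"
    using local_fun_algorithm[of t \<Phi>] by blast
  have "(\<lambda>n. real (t n)) \<in> O(\<lambda>n. real (log_star n))"
  proof (rule bigoI)
    \<comment> \<open>From \<open>n = 3\<close> on \<open>log_star n\<close> is positive and absorbs
      the constant radius.\<close>
    have "norm (real (t n)) \<le> real (r + brooks_radius R K) * norm (real (log_star n))" if n: "n \<ge> 3" for n
    proof -
      have "log_star n \<noteq> 0" using log_star_le_2[of n] n by (intro notI) simp
      then have "brooks_radius R K * 1 \<le> brooks_radius R K * log_star n" by (intro mult_le_mono2) simp
      then have "t n \<le> (r + brooks_radius R K) * log_star n" by (simp add: t_def algebra_simps)
      then have "real (t n) \<le> real ((r + brooks_radius R K) * log_star n)" by (simp only: of_nat_le_iff)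
      then show ?thesis by simp
    qed
    then show "\<forall>\<^sub>F n in at_top. norm (real (t n)) \<le> real (r + brooks_radius R K) * norm (real (log_star n))"
      unfolding eventually_at_top_linorder by blast
  qed
  moreover have "proper_coloring \<Delta> G (local_output A t G ident)"
    if G: "G \<in> F" and ident: "identifier_assignment c G ident" for G ident
  proof (cases "pverts G = {}")
    case True
    interpret pair_graph G using assms(3) G by blast
    show ?thesis using True in_arcsD1 unfolding proper_coloring_def by auto
  next
    case False
    interpret pair_graph G using assms(3) G by blast
    interpret identified_graph G ident
      using ident unfolding identifier_assignment_def by unfold_locales blast
    define n where "n = card (pverts G)"
    have n1: "1 \<le> n" using False pair_finite_verts by (simp add: n_def Suc_le_eq card_gt_0_iff)
    have id_le: "ident v \<le> n ^ c" if "v \<in> pverts G" for v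
      using ident that unfolding identifier_assignment_def n_def by force
    have growth: "growth_bounded f G" using assms(4) G by blast
    let ?a = "\<lambda>x. if x \<le> n ^ c then x else 0"
    have red: "(\<forall>x. \<kappa> n E x < 2 ^ bits d ((c + 1) * n) (log_star n)) \<and>
      (\<forall>x. \<forall>y\<in>nball E x r. x \<noteq> y \<longrightarrow> \<kappa> n E x \<noteq> \<kappa> n E y)"
      unfolding \<kappa>_def
    proof (rule reduced_proper)
      show "card (nball E x r) \<le> d" for x using card_nball_le[OF growth] by (simp add: d_def)
      \<comment> \<open>A generous bit length from \<open>n < 2 ^ n\<close>, linear in
        \<open>n\<close> as the bit bound expects; \<open>c + 1\<close> instead of \<open>c\<close>
        makes the inequality strict.\<close>
      show "?a x < 2 ^ ((c + 1) * n)" for x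
      proof -
        have "?a x \<le> n ^ c" by simp
        also have "\<dots> \<le> (2 ^ n) ^ c" using less_exp[of n] by (intro power_mono) auto
        also have "\<dots> = 2 ^ (c * n)" by (simp add: power_mult[symmetric] mult.commute)
        also have "\<dots> < 2 ^ ((c + 1) * n)" using n1 by (intro power_strict_increasing) auto
        finally show ?thesis .
      qed
      show "?a x \<noteq> ?a y" if "y \<in> nball E x r" "x \<noteq> y" for x y
      proof -
        \<comment> \<open>Distinct points at finite distance have neighbours, so both are genuine
          identifiers and the default 0 does not apply to them.\<close>
        have ne: "E `` {z} \<noteq> {}" if zw: "w \<in> nball E z r" "w \<noteq> z" for z w
        proof
          assume "E `` {z} = {}"
          then have "nball E z r = {z}" by (induction r) (auto simp: nball.simps)
          with zw show False by simp
        qed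
        have "z \<le> n ^ c" if "E `` {z} \<noteq> {}" for z using that id_le by (blast elim: E_in)
        then have "x \<le> n ^ c" "y \<le> n ^ c" using ne[of y x] ne[of x y] nball_sym[OF that(1)] that by auto
        then show ?thesis using that(2) by simp
      qed
    qed
    have "bits d ((c + 1) * n) (log_star n) \<le> 2 * C"
    proof -
      have "real (bits d ((c + 1) * n) (log_star n)) \<le> real C * (log 2 ^^ log_star n) (real n)"
        using bits_le_iterated_log[OF C_def _ _ n1, of d "c + 1" "log_star n"] by (simp add: e_def)
      also have "\<dots> \<le> real C * 2" using log_star_le_2 by (intro mult_left_mono) auto
      finally show ?thesis by simp
    qed
    then have "2 ^ bits d ((c + 1) * n) (log_star n) \<le> K"
      unfolding K_def by (intro power_increasing) auto
    then have \<kappa>K: "\<kappa> n E x < K" for x using red less_le_trans by blast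
    have core: "\<exists>D \<subseteq> nball E x R. core \<Delta> E D" for x
      unfolding R_def
    proof (rule ex_core)
      show "card (E `` {y}) \<le> \<Delta>" for y using card_neighbours assms(5) G by blast
      show "\<not> clique E Q" if "card Q = \<Delta> + 1" for Q
        using clique_free[OF _ _ that] assms(1,6) G by auto
      show "card (nball E x (2 * k + 2)) < 2 ^ k" if "E `` {x} \<noteq> {}"
        using card_nball[OF growth that, of "2 * k + 2"] k by simp
    qed (rule assms(1))
    interpret coloured_graph E "\<kappa> n E" \<Delta> R K
    proof
      show "card (E `` {x}) \<le> \<Delta>" for x using card_neighbours assms(5) G by blast
      show "\<kappa> n E x \<noteq> \<kappa> n E y" if "y \<in> nball E x (2 * R + 1)" "x \<noteq> y" for x y
        using red that unfolding r_def by blast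
    qed (use core \<kappa>K in auto)
    have out: "local_output A t G ident v = \<Phi> n E (ident v)" if "v \<in> pverts G" for v
      unfolding local_output_def Let_def n_def[symmetric] local_view_eq[OF that] A ..
    show ?thesis
      unfolding proper_coloring_def
    proof (intro conjI ballI)
      show "local_output A t G ident v < \<Delta>" if "v \<in> pverts G" for v
        unfolding out[OF that] \<Phi>_def by (rule brooks_less)
      fix a assume a: "a \<in> parcs G"
      obtain u v where uv: "a = (u, v)" by fastforce
      then have "(ident u, ident v) \<in> E" "u \<in> pverts G" "v \<in> pverts G"
        using a E_iff in_arcsD1 in_arcsD2 by blast+
      then show "case a of (u, v) \<Rightarrow> local_output A t G ident u \<noteq> local_output A t G ident v"
        using out brooks_proper unfolding uv \<Phi>_def by simp
    qed
  qed
  ultimately show ?thesis by blast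
qed

end
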